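(* The Morita equivalence of regular rational-faced framed simple convex polytopes is a true equivalence relation.
   Context: **Framed polytopes.** An $n$-dimensional convex polytope $P$ is simple if each $s$-dimensional face is contained in exactly $n-s$ faces of dimension $s+1$. Integral affine coordinate systems on $\mathbb{R}^N$ are those obtained from the standard one by elements of $GL(N,\mathbb{Z})\ltimes\mathbb{R}^N$. A regular rational-faced framing of a convex simple $n$-dimensional polytope $P\subset\mathbb{R}^N$ is a pair $(L,Q)$, where $L$ is the $n$-dimensional affine subspace containing $P$ and $Q\subset\mathbb{R}^N$ is an $N$-dimensional locally-polyhedral set such that for any point $x_0\in Q$ lying on a face of codimension $s$ there is an integral affine coordinate system $(h_1,\dots,h_N)$ such that near $x_0$ the set $Q$ is given by $h_1\ge0,\dots,h_s\ge0$, with $h_1,\dots,h_s$ vanishing at $x_0$ (rationality, simplicity and regularity conditions of a Delzant polytope), and such that $L$ intersects $Q$ (all its faces) transversally and $L\cap Q=P$. Then $P$ with the framing, denoted $(P,Q)$, is a regular rational-faced framed polytope; only the germ of $Q$ along $P$ matters. **Integral affine embeddings.** An integral affine embedding $\eta:\mathbb{R}^{N_1}\to\mathbb{R}^{N_2}$ ($N_1\le N_2$) is an injective affine map such that, up to a translation, $\eta(\mathbb{Z}^{N_1})$ is a sublattice of $\mathbb{Z}^{N_2}$ with torsion-free quotient $\mathbb{Z}^{N_2}/\eta(\mathbb{Z}^{N_1})$. **Morita equivalence.** Let $(P_1,Q_1)$ in $\mathbb{R}^{N_1}$ and $(P_2,Q_2)$ in $\mathbb{R}^{N_2}$ be regular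 rational-faced framed polytopes, $N_1\ge N_2$. A Morita equivalence embedding from $(P_2,Q_2)$ to $(P_1,Q_1)$ is an integral affine embedding $\eta:\mathbb{R}^{N_2}\to\mathbb{R}^{N_1}$ with $\eta(P_2)=P_1$ and $\eta(U(P_2))=U(P_1)\cap\eta(\mathbb{R}^{N_2})$, where $U(P_i)$ is a small neighborhood of $P_i$ in $Q_i$. Two framed polytopes are called Morita-equivalent if both of them admit Morita equivalence embeddings to a third framed polytope. *)

theory Defs
  imports
    "HOL-Analysis.Analysis"
    "HOL-Library.Function_Algebras"
    "HOL-Algebra.Coset"
    "Jordan_Normal_Form.Matrix"
begin

text \<open>
  The ambient dimension varies inside the notions below, so \<open>\<real>\<^sup>N\<close> is the carrier of the library
  space \<^const>\<open>Euclidean_space\<close>, consisting of the sequences that vanish from index \<open>N\<close> on. The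
  pointwise vector space structure on functions makes convex hulls, affine hulls and faces from
  HOL-Analysis available for subsets of this carrier.
\<close>

instantiation "fun" :: (type, real_vector) real_vector
begin

definition scaleR_fun :: "real \<Rightarrow> ('a \<Rightarrow> 'b) \<Rightarrow> 'a \<Rightarrow> 'b"
  where "scaleR_fun c f = (\<lambda>x. c *\<^sub>R f x)"

instance
  by standard (simp_all add: scaleR_fun_def fun_eq_iff scaleR_add_right scaleR_add_left)

end

type_synonym point = "nat \<Rightarrow> real"

abbreviation Rn :: "nat \<Rightarrow> point set"
  where "Rn N \<equiv> topspace (Euclidean_space N)"


section \<open>Simple convex polytopes\<close>

text \<open>
  The library's \<^const>\<open>aff_dim\<close> has the same characterization, but it is only available on
  types of class \<^class>\<open>euclidean_space\<close>. The empty set has no dimension in the sense below, so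
  the empty face does not count as a face of dimension \<open>s\<close>.
\<close>

definition has_aff_dim :: "point set \<Rightarrow> nat \<Rightarrow> bool"
  where "has_aff_dim S d \<longleftrightarrow>
    (\<exists>B. affine hull B = affine hull S \<and> \<not> affine_dependent B \<and> card B = d + 1)"

definition simple_polytope :: "nat \<Rightarrow> point set \<Rightarrow> bool"
  where "simple_polytope n P \<longleftrightarrow>
    polytope P \<and> has_aff_dim P n \<and>
    (\<forall>s\<le>n. \<forall>F. F face_of P \<and> has_aff_dim F s \<longrightarrow>
       card {G. G face_of P \<and> has_aff_dim G (s + 1) \<and> F \<subseteq> G} = n - s)"


section \<open>Integral affine coordinates and framings\<close>

definition GL_int :: "nat \<Rightarrow> int mat set"
  where "GL_int N = {A \<in> carrier_mat N N. invertible_mat A}"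

definition lin_coord :: "int mat \<Rightarrow> nat \<Rightarrow> point \<Rightarrow> real"
  where "lin_coord A i v = (\<Sum>j<dim_col A. of_int (A $$ (i, j)) * v j)"

definition aff_coord :: "int mat \<Rightarrow> point \<Rightarrow> nat \<Rightarrow> point \<Rightarrow> real"
  where "aff_coord A b i x = lin_coord A i x + b i"

text \<open>
  The pair \<open>(A, b)\<close> with \<open>A \<in> GL_int N\<close> stands for the integral affine coordinate system
  \<open>(h\<^sub>1, \<dots>, h\<^sub>N)\<close> with \<open>h\<^sub>i = aff_coord A b (i - 1)\<close>; coordinates are numbered from 0.
  The number \<open>s\<close> is the codimension of the smallest face of \<open>Q\<close> through \<open>x\<^sub>0\<close>.
\<close>

definition corner_chart :: "nat \<Rightarrow> point set \<Rightarrow> point \<Rightarrow> nat \<Rightarrow> int mat \<Rightarrow> point \<Rightarrow> bool"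
  where "corner_chart N Q x0 s A b \<longleftrightarrow>
    s \<le> N \<and> A \<in> GL_int N \<and> b \<in> Rn N \<and>
    (\<forall>i<s. aff_coord A b i x0 = 0) \<and>
    (\<exists>U. openin (Euclidean_space N) U \<and> x0 \<in> U \<and>
         Q \<inter> U = {x \<in> U. \<forall>i<s. aff_coord A b i x \<ge> 0})"

definition direction_space :: "point set \<Rightarrow> point set"
  where "direction_space L = {x - y |x y. x \<in> L \<and> y \<in> L}"

text \<open>
  Near \<open>x\<^sub>0\<close> the faces of \<open>Q\<close> through \<open>x\<^sub>0\<close> are the sets \<open>{x \<in> Q. h\<^sub>j(x) = 0 for all j \<in> J}\<close>
  with \<open>J\<close> a set of indices below \<open>s\<close>. Transversality says that the direction space of \<open>L\<close> and
  the tangent space of each of these faces together span \<open>\<real>\<^sup>N\<close>.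
\<close>

definition transversal :: "nat \<Rightarrow> point set \<Rightarrow> point set \<Rightarrow> bool"
  where "transversal N L Q \<longleftrightarrow>
    (\<forall>x0 \<in> L \<inter> Q. \<forall>s A b. corner_chart N Q x0 s A b \<longrightarrow>
      (\<forall>J \<subseteq> {..<s}.
         {u + v |u v. u \<in> direction_space L \<and> v \<in> Rn N \<and> (\<forall>j\<in>J. lin_coord A j v = 0)} = Rn N))"

text \<open>
  \<open>L\<close> is the affine hull of \<open>P\<close>: for an \<open>n\<close>-dimensional \<open>P\<close> no other \<open>n\<close>-dimensional
  affine subspace contains \<open>P\<close>. The
  set \<open>Q\<close> need not be closed: it represents its germ along \<open>P\<close>, and may be cut down to any open
  neighbourhood of \<open>P\<close>. The corner charts entail that \<open>Q\<close> is locally polyhedral.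
\<close>

definition regular_rational_framing :: "nat \<Rightarrow> point set \<Rightarrow> point set \<Rightarrow> point set \<Rightarrow> bool"
  where "regular_rational_framing N P L Q \<longleftrightarrow>
    L = affine hull P \<and>
    Q \<subseteq> Rn N \<and> has_aff_dim Q N \<and>
    (\<forall>x0\<in>Q. \<exists>s A b. corner_chart N Q x0 s A b) \<and>
    transversal N L Q \<and>
    L \<inter> Q = P"

record framed =
  ambient_dim :: nat
  body :: "point set"
  frame :: "point set"

definition framed_polytope :: "framed \<Rightarrow> bool"
  where "framed_polytope X \<longleftrightarrow>
    body X \<subseteq> Rn (ambient_dim X) \<and>
    (\<exists>n L. simple_polytope n (body X) \<and>
       regular_rational_framing (ambient_dim X) (body X) L (frame X))"


section \<open>Integral affine embeddings\<close>

definition int_lattice :: "nat \<Rightarrow> point monoid"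
  where "int_lattice N = \<lparr>carrier = {x \<in> Rn N. \<forall>i. x i \<in> \<int>}, mult = (+), one = 0\<rparr>"

definition torsion_free :: "('a, 'b) monoid_scheme \<Rightarrow> bool"
  where "torsion_free G \<longleftrightarrow>
    (\<forall>x\<in>carrier G. \<forall>k::nat. k > 0 \<and> x [^]\<^bsub>G\<^esub> k = \<one>\<^bsub>G\<^esub> \<longrightarrow> x = \<one>\<^bsub>G\<^esub>)"

definition affine_map :: "nat \<Rightarrow> nat \<Rightarrow> (point \<Rightarrow> point) \<Rightarrow> bool"
  where "affine_map N M \<eta> \<longleftrightarrow>
    \<eta> ` Rn N \<subseteq> Rn M \<and> (\<exists>f c. linear f \<and> (\<forall>x\<in>Rn N. \<eta> x = f x + c))"

definition integral_affine_embedding :: "nat \<Rightarrow> nat \<Rightarrow> (point \<Rightarrow> point) \<Rightarrow> bool"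
  where "integral_affine_embedding N M \<eta> \<longleftrightarrow>
    N \<le> M \<and> affine_map N M \<eta> \<and> inj_on \<eta> (Rn N) \<and>
    (\<exists>t\<in>Rn M. let \<Lambda> = (\<lambda>z. \<eta> z + t) ` carrier (int_lattice N) in
       subgroup \<Lambda> (int_lattice M) \<and> torsion_free (int_lattice M Mod \<Lambda>))"


section \<open>Morita equivalence\<close>

definition nbhd_in :: "nat \<Rightarrow> point set \<Rightarrow> point set \<Rightarrow> point set \<Rightarrow> bool"
  where "nbhd_in N Q P U \<longleftrightarrow> openin (subtopology (Euclidean_space N) Q) U \<and> P \<subseteq> U"

text \<open>
  The neighbourhoods may equivalently be required to be arbitrarily small: if \<open>U\<^sub>1\<close>, \<open>U\<^sub>2\<close> satisfy
  the equation, so do any smaller \<open>V\<^sub>1\<close> and the preimage of \<open>V\<^sub>1\<close> in \<open>U\<^sub>2\<close>.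
\<close>

definition morita_embedding :: "framed \<Rightarrow> framed \<Rightarrow> (point \<Rightarrow> point) \<Rightarrow> bool"
  where "morita_embedding X2 X1 \<eta> \<longleftrightarrow>
    integral_affine_embedding (ambient_dim X2) (ambient_dim X1) \<eta> \<and>
    \<eta> ` body X2 = body X1 \<and>
    (\<exists>U2 U1. nbhd_in (ambient_dim X2) (frame X2) (body X2) U2 \<and>
       nbhd_in (ambient_dim X1) (frame X1) (body X1) U1 \<and>
       \<eta> ` U2 = U1 \<inter> \<eta> ` Rn (ambient_dim X2))"

definition morita_equivalent :: "framed \<Rightarrow> framed \<Rightarrow> bool"
  where "morita_equivalent X Y \<longleftrightarrow>
    (\<exists>Z. framed_polytope Z \<and> (\<exists>\<eta>. morita_embedding X Z \<eta>) \<and> (\<exists>\<eta>. morita_embedding Y Z \<eta>))"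

end

theory Submission
  imports Defs
begin

text \<open>
  Transitivity is the only substantial point. It is obtained by describing Morita equivalence
  without the third polytope, by a condition that is visibly an equivalence relation.

  Near its body, the frame of a framed polytope is cut out by finitely many primitive integral
  affine functions \<open>h\<close>, one for each facet (\<open>facet_functions\<close>, \<open>frame_eq_facets_near_body\<close>). They
  are intrinsic, because a simplicial cone determines the functions that define it up to positive
  factors (\<open>dual_cones_proportional\<close>) and primitivity removes the factors
  (\<open>local_facets_unique\<close>). The condition \<open>facet_equiv X Y\<close> asks for integral affine maps \<open>S\<close> and
  \<open>T\<close> between the two ambient spaces, neither of them necessarily injective, which restrict to
  mutually inverse bijections of the bodies and such that, on the body, the facet functions of \<open>X\<close>
  and those of \<open>Y\<close> pulled back by \<open>S\<close> agree up to positive rational factors. Integral affine maps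
  compose and positive rational numbers form a group, so this is an equivalence relation. It
  remains to see that it is Morita equivalence.

  A Morita embedding \<open>\<eta>\<close> of \<open>X\<close> into \<open>Z\<close> yields \<open>facet_equiv X Z\<close>. The torsion-free quotient
  provides an integral retraction of \<open>\<eta>\<close> (\<open>integral_affine_embedding_retract\<close>). At a point of the
  body, the facet functions of \<open>X\<close> and the pullbacks of those of \<open>Z\<close> define the same cone, and by
  transversality the pullbacks are still linearly independent, so the two families agree up to
  positive factors (\<open>morita_embedding_facets\<close>). These factors are integers, as the facet functions
  of \<open>X\<close> are primitive. They need not be \<open>1\<close>: a primitive function may become divisible when it is
  restricted to a direct summand of the lattice.

  Conversely let \<open>S\<close>, \<open>T\<close> be as above and let \<open>\<alpha> h = \<beta> (g \<circ> S)\<close> on the body of \<open>X\<close> for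
  corresponding facet functions \<open>h\<close>, \<open>g\<close> and positive integers \<open>\<alpha>\<close>, \<open>\<beta>\<close> (one such equation for each of
  the \<open>m\<close> facets). In the space of triples \<open>(x, y, w)\<close>, with one coordinate of \<open>w\<close> per facet,
  consider the graphs
  \<open>x \<mapsto> (x, S x, 0)\<close> and \<open>y \<mapsto> (T y, y, \<beta> g(y) - \<alpha> h(T y))\<close>.
  They agree on the bodies, and the functions \<open>\<alpha> h(x) + w\<close> pull back to \<open>\<alpha> h\<close> along the first and
  to \<open>\<beta> g\<close> along the second. Their linear parts belong to a lattice basis whatever \<open>\<alpha> h\<close> is,
  because of the summand \<open>w\<close>. Hence they define a framing into which both polytopes
  embed (locale \<open>matched_polytopes\<close>).
\<close>


section \<open>Integral affine functions\<close>

lemma Rn_iff: "x \<in> Rn N \<longleftrightarrow> (\<forall>i\<ge>N. x i = 0)"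
  by (simp add: topspace_Euclidean_space)

lemma point_scaleR_apply [simp]: "((r::real) *\<^sub>R x) i = r *\<^sub>R x i" for x :: "'a \<Rightarrow> 'b::real_vector"
  by (simp add: scaleR_fun_def)

lemma point_sum_apply [simp]: "(\<Sum>a\<in>A. f a) i = (\<Sum>a\<in>A. f a i)"
  for f :: "'a \<Rightarrow> 'c \<Rightarrow> 'b::comm_monoid_add"
  by (induction A rule: infinite_finite_induct) auto

lemma subspace_Rn: "subspace (Rn N)"
  by (auto simp: subspace_def Rn_iff)

text \<open>
  Such a function reads only the coordinates below \<open>N\<close>, so it is determined by its values on
  \<open>\<real>\<^sup>N\<close>, and sets of functions can be compared by plain equality.
\<close>

definition int_affine :: "nat \<Rightarrow> (point \<Rightarrow> real) \<Rightarrow> bool"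
  where "int_affine N h \<longleftrightarrow> (\<exists>(a::nat \<Rightarrow> int) c. h = (\<lambda>x. (\<Sum>j<N. of_int (a j) * x j) + c))"

definition lin_part :: "(point \<Rightarrow> real) \<Rightarrow> point \<Rightarrow> real"
  where "lin_part h v = h v - h 0"

abbreviation Zn :: "nat \<Rightarrow> point set"
  where "Zn N \<equiv> {x \<in> Rn N. \<forall>i. x i \<in> \<int>}"

lemma linear_lin_part: "int_affine N h \<Longrightarrow> linear (lin_part h)"
  unfolding int_affine_def lin_part_def
  by (auto intro!: linearI simp: algebra_simps sum.distrib sum_distrib_left)

lemma lin_part_diff:
  assumes "int_affine N h" shows "lin_part h (x - y) = h x - h y"
  using linear_diff[OF linear_lin_part[OF assms], of x y] by (simp add: lin_part_def)

lemma int_affine_along_line: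
  assumes "int_affine N h" shows "h (x + t *\<^sub>R v) = h x + t * lin_part h v"
  using lin_part_diff[OF assms, of "x + t *\<^sub>R v" x] linear_scale[OF linear_lin_part[OF assms], of t v]
  by simp

lemma continuous_on_int_affine: "int_affine N h \<Longrightarrow> continuous_on UNIV h"
  unfolding int_affine_def by (auto intro!: continuous_intros)

lemma lin_part_Ints:
  assumes "int_affine N h" "\<forall>i. v i \<in> \<int>" shows "lin_part h v \<in> \<int>"
  using assms unfolding int_affine_def lin_part_def by (auto intro!: Ints_sum Ints_mult)

definition trunc :: "nat \<Rightarrow> point \<Rightarrow> point"
  where "trunc N x = (\<lambda>i. if i < N then x i else 0)"

lemma trunc_in_Rn [simp]: "trunc N x \<in> Rn N"
  by (simp add: Rn_iff trunc_def)

lemma trunc_Rn: "x \<in> Rn N \<Longrightarrow> trunc N x = x"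
  by (auto simp: trunc_def Rn_iff)

lemma int_affine_trunc: "int_affine N h \<Longrightarrow> h (trunc N x) = h x"
  unfolding int_affine_def trunc_def by auto

lemma int_affine_eqI:
  assumes "int_affine N g" "int_affine N h" "\<And>x. x \<in> Rn N \<Longrightarrow> g x = h x"
  shows "g = h"
  by (metis assms int_affine_trunc trunc_in_Rn ext)

lemma int_affine_const [simp]: "int_affine N (\<lambda>x. c)"
  unfolding int_affine_def by (rule exI[of _ "\<lambda>_. 0"]) auto

lemma int_affine_coord: "i < N \<Longrightarrow> int_affine N (\<lambda>x. x i)"
  unfolding int_affine_def
  by (rule exI[of _ "\<lambda>j. if j = i then 1 else 0"], rule exI[of _ 0])
     (simp add: if_distrib[of of_int] if_distrib[of "\<lambda>z. z * _"] cong: if_cong)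

lemma int_affine_add:
  assumes "int_affine N g" "int_affine N h" shows "int_affine N (\<lambda>x. g x + h x)"
proof -
  obtain a b c d where "g = (\<lambda>x. (\<Sum>j<N. of_int (a j) * x j) + c)"
    "h = (\<lambda>x. (\<Sum>j<N. of_int (b j) * x j) + d)"
    using assms unfolding int_affine_def by metis
  then have "(\<lambda>x. g x + h x) = (\<lambda>x. (\<Sum>j<N. of_int (a j + b j) * x j) + (c + d))"
    by (simp add: sum.distrib algebra_simps)
  then show ?thesis unfolding int_affine_def by (intro exI)
qed

lemma int_affine_cmult:
  assumes "int_affine N h" shows "int_affine N (\<lambda>x. of_int k * h x)"
proof -
  obtain a c where "h = (\<lambda>x. (\<Sum>j<N. of_int (a j) * x j) + c)"
    using assms unfolding int_affine_def by metis
  then have "(\<lambda>x. of_int k * h x) = (\<lambda>x. (\<Sum>j<N. of_int (k * a j) * x j) + of_int k * c)"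
    by (simp add: sum_distrib_left algebra_simps)
  then show ?thesis unfolding int_affine_def by (intro exI)
qed

lemma int_affine_sum:
  "(\<And>j. j \<in> A \<Longrightarrow> int_affine N (h j)) \<Longrightarrow> int_affine N (\<lambda>x. \<Sum>j\<in>A. h j x)"
  by (induction A rule: infinite_finite_induct) (auto intro: int_affine_add)

lemma int_affine_diff:
  assumes "int_affine N g" "int_affine N h" shows "int_affine N (\<lambda>x. g x - h x)"
  using int_affine_add[OF assms(1) int_affine_cmult[OF assms(2), of "-1"]] by simp

definition int_affine_map :: "nat \<Rightarrow> nat \<Rightarrow> (point \<Rightarrow> point) \<Rightarrow> bool"
  where "int_affine_map N M S \<longleftrightarrow> (\<forall>i. int_affine N (\<lambda>x. S x i)) \<and> (\<forall>x. S x \<in> Rn M)"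

lemma int_affine_compose:
  assumes "int_affine M h" "int_affine_map N M S" shows "int_affine N (\<lambda>x. h (S x))"
proof -
  obtain a c where "h = (\<lambda>x. (\<Sum>j<M. of_int (a j) * x j) + c)"
    using assms(1) unfolding int_affine_def by metis
  then show ?thesis
    using assms(2) unfolding int_affine_map_def
    by (auto intro!: int_affine_add int_affine_sum int_affine_cmult)
qed

lemma int_affine_map_compose:
  "int_affine_map N M S \<Longrightarrow> int_affine_map M K T \<Longrightarrow> int_affine_map N K (\<lambda>x. T (S x))"
  using int_affine_compose[of M "\<lambda>x. T x i" for i] unfolding int_affine_map_def by blast

lemma int_affine_map_trunc: "N \<le> D \<Longrightarrow> int_affine_map D N (trunc N)"
proof -
  assume "N \<le> D"
  then have "int_affine D (\<lambda>x. trunc N x i)" for i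
    by (cases "i < N") (simp_all add: trunc_def int_affine_coord)
  then show ?thesis by (simp add: int_affine_map_def)
qed

lemma int_affine_mono:
  assumes "int_affine N f" "N \<le> D" shows "int_affine D f"
  using int_affine_compose[OF assms(1) int_affine_map_trunc[OF assms(2)]]
  by (simp add: int_affine_trunc[OF assms(1)])

lemma continuous_on_int_affine_map: "int_affine_map N M S \<Longrightarrow> continuous_on UNIV S"
  unfolding int_affine_map_def
  by (auto intro!: continuous_on_coordinatewise_then_product continuous_on_int_affine)


section \<open>Open sets of the Euclidean carrier\<close>

lemma openin_Rn: "openin (Euclidean_space N) U \<longleftrightarrow> (\<exists>W. open W \<and> U = Rn N \<inter> W)"
proof -
  have "Euclidean_space N = top_of_set (Rn N)"
    by (simp add: Euclidean_space_def euclidean_product_topology)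
  then show ?thesis by (metis openin_open)
qed

lemma openin_Rn_preimage:
  assumes "openin (Euclidean_space M) V" "continuous_on UNIV S" "\<And>x. x \<in> Rn N \<Longrightarrow> S x \<in> Rn M"
  shows "openin (Euclidean_space N) {x \<in> Rn N. S x \<in> V}"
proof -
  obtain W where W: "open W" "V = Rn M \<inter> W" using assms(1) openin_Rn by auto
  have "open (S -` W)" using open_vimage[OF W(1) assms(2)] .
  moreover have "{x \<in> Rn N. S x \<in> V} = Rn N \<inter> S -` W" using W assms(3) by auto
  ultimately show ?thesis unfolding openin_Rn by blast
qed

lemma openin_Rn_pos:
  assumes "finite H" "\<And>h. h \<in> H \<Longrightarrow> int_affine N (f h)"
  shows "openin (Euclidean_space N) {x \<in> Rn N. \<forall>h\<in>H. 0 < f h x}"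
proof -
  have "open (\<Inter>h\<in>H. {x. 0 < f h x})"
    using assms by (intro open_INT ballI open_Collect_less continuous_on_int_affine) auto
  moreover have "{x \<in> Rn N. \<forall>h\<in>H. 0 < f h x} = Rn N \<inter> (\<Inter>h\<in>H. {x. 0 < f h x})" by auto
  ultimately show ?thesis unfolding openin_Rn by blast
qed

lemma openin_line_preimage:
  assumes "openin (Euclidean_space N) U" "p \<in> Rn N" "v \<in> Rn N"
  shows "open {t. p + t *\<^sub>R v \<in> U}"
proof -
  obtain W where W: "open W" "U = Rn N \<inter> W" using assms(1) openin_Rn by auto
  have "continuous_on UNIV (\<lambda>t. p + t *\<^sub>R v)"
    by (intro continuous_on_coordinatewise_then_product) (auto intro!: continuous_intros)
  from open_vimage[OF W(1) this] have "open {t. p + t *\<^sub>R v \<in> W}" by (simp add: vimage_def)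
  moreover have "p + t *\<^sub>R v \<in> Rn N" for t
    using assms(2,3) by (auto simp: Rn_iff)
  ultimately show ?thesis using W by simp
qed

lemma openin_ray:
  assumes "openin (Euclidean_space N) U" "p \<in> U" "v \<in> Rn N"
  obtains t where "t > 0" "t \<le> 1" "p + t *\<^sub>R v \<in> U"
proof -
  have "p \<in> Rn N" using assms openin_subset by fastforce
  have "open {t. p + t *\<^sub>R v \<in> U}" by (rule openin_line_preimage) fact+
  moreover have "0 \<in> {t. p + t *\<^sub>R v \<in> U}" using assms(2) by simp
  ultimately obtain e where "e > 0" "ball 0 e \<subseteq> {t. p + t *\<^sub>R v \<in> U}"
    using openE by blast
  then have "p + (min 1 (e/2)) *\<^sub>R v \<in> U" by (auto simp: subset_iff)
  then show ?thesis using that[of "min 1 (e/2)"] \<open>e > 0\<close> by simp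
qed


section \<open>Facet functions at a point\<close>

text \<open>
  Subtracting from \<open>x\<close> its components along the \<open>w j\<close> leaves a vector \<open>y\<close> in the lineality space of
  the cone. Both \<open>y\<close> and \<open>- y\<close> lie in the cone, so a functional that is nonnegative on the
  cone vanishes at \<open>y\<close>.
\<close>

lemma nonneg_on_simplicial_cone_expansion:
  fixes a :: "'v::real_vector \<Rightarrow> real"
  assumes "finite K" "subspace V" "linear a" and lin: "\<And>j. j \<in> K \<Longrightarrow> linear (b j)"
    and w: "\<And>j. j \<in> K \<Longrightarrow> w j \<in> V"
    and dual: "\<And>j k. j \<in> K \<Longrightarrow> k \<in> K \<Longrightarrow> b k (w j) = (if k = j then 1 else 0)"
    and pos: "\<And>x. x \<in> V \<Longrightarrow> (\<forall>k\<in>K. 0 \<le> b k x) \<Longrightarrow> 0 \<le> a x" and x: "x \<in> V"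
  shows "a x = (\<Sum>j\<in>K. a (w j) * b j x)"
proof -
  define y where "y = x - (\<Sum>j\<in>K. b j x *\<^sub>R w j)"
  have yV: "y \<in> V" unfolding y_def using w x assms(2)
    by (intro subspace_diff subspace_sum subspace_scale) auto
  have "b k y = 0" if k: "k \<in> K" for k
  proof -
    have "b k y = b k x - (\<Sum>j\<in>K. b j x * b k (w j))"
      unfolding y_def using lin[OF k] by (simp add: linear_diff linear_sum linear_scale)
    also have "(\<Sum>j\<in>K. b j x * b k (w j)) = (\<Sum>j\<in>K. if k = j then b j x else 0)"
      using dual k by (intro sum.cong) auto
    finally show ?thesis using k \<open>finite K\<close> by simp
  qed
  then have "0 \<le> a y" "0 \<le> a (- y)"
    using pos[OF yV] pos[of "-y"] subspace_neg[OF assms(2) yV] lin by (auto simp: linear_neg)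
  then have "a y = 0" using linear_neg[OF \<open>linear a\<close>] by simp
  then show ?thesis unfolding y_def using \<open>linear a\<close>
    by (simp add: linear_diff linear_sum linear_scale mult.commute)
qed

text \<open>
  Each family is a nonnegative combination of the other. The coefficient matrices are
  nonnegative and inverse to each other, so each row has exactly one nonzero entry.
\<close>

lemma dual_cones_proportional:
  fixes f :: "'i \<Rightarrow> 'v::real_vector \<Rightarrow> real" and g :: "'j \<Rightarrow> 'v \<Rightarrow> real"
  assumes fin: "finite I" "finite J"
    and lin: "\<And>i. i \<in> I \<Longrightarrow> linear (f i)" "\<And>j. j \<in> J \<Longrightarrow> linear (g j)"
    and V: "subspace V"
    and u: "\<And>i. i \<in> I \<Longrightarrow> u i \<in> V" "\<And>i k. i \<in> I \<Longrightarrow> k \<in> I \<Longrightarrow> f k (u i) = (if k = i then 1 else 0)"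
    and v: "\<And>j. j \<in> J \<Longrightarrow> v j \<in> V" "\<And>j k. j \<in> J \<Longrightarrow> k \<in> J \<Longrightarrow> g k (v j) = (if k = j then 1 else 0)"
    and cone: "\<And>x. x \<in> V \<Longrightarrow> (\<forall>i\<in>I. 0 \<le> f i x) \<longleftrightarrow> (\<forall>j\<in>J. 0 \<le> g j x)"
    and i: "i \<in> I"
  shows "\<exists>j\<in>J. \<exists>c>0. \<forall>x\<in>V. f i x = c * g j x"
proof -
  have f_exp: "f k x = (\<Sum>j\<in>J. f k (v j) * g j x)" if "k \<in> I" "x \<in> V" for k x
    by (rule nonneg_on_simplicial_cone_expansion[where V = V]) (use fin lin v V that in \<open>simp_all add: cone[symmetric]\<close>)
  have g_exp: "g j x = (\<Sum>k\<in>I. g j (u k) * f k x)" if "j \<in> J" "x \<in> V" for j x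
    by (rule nonneg_on_simplicial_cone_expansion[where V = V]) (use fin lin u V that in \<open>simp_all add: cone\<close>)
  have f_nonneg: "0 \<le> f k (v j)" if "k \<in> I" "j \<in> J" for k j
  proof -
    have "\<forall>i\<in>J. 0 \<le> g i (v j)" using v(2)[OF that(2)] by simp
    then show ?thesis using cone[OF v(1)[OF that(2)]] that(1) by blast
  qed
  have g_nonneg: "0 \<le> g j (u k)" if "k \<in> I" "j \<in> J" for k j
  proof -
    have "\<forall>i\<in>I. 0 \<le> f i (u k)" using u(2)[OF that(1)] by simp
    then show ?thesis using cone[OF u(1)[OF that(1)]] that(2) by blast
  qed
  have "(\<Sum>j\<in>J. f i (v j) * g j (u i)) = 1" using f_exp[of i "u i"] u i by simp
  then have "(\<Sum>j\<in>J. f i (v j) * g j (u i)) \<noteq> 0" by simp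
  then obtain j where j: "j \<in> J" "f i (v j) * g j (u i) \<noteq> 0"
    by (elim sum.not_neutral_contains_not_neutral)
  have other: "g j (u k) = 0" if k: "k \<in> I" "k \<noteq> i" for k
  proof -
    have "(\<Sum>j\<in>J. f i (v j) * g j (u k)) = 0" using f_exp[of i "u k"] u i k by simp
    then have "f i (v j) * g j (u k) = 0"
      using sum_nonneg_eq_0_iff[OF fin(2), of "\<lambda>j. f i (v j) * g j (u k)"]
        mult_nonneg_nonneg[OF f_nonneg[OF i] g_nonneg[OF k(1)]] j(1) by blast
    then show ?thesis using j(2) by simp
  qed
  have eq: "g j x = g j (u i) * f i x" if "x \<in> V" for x
  proof -
    have "g j x = (\<Sum>k\<in>I. g j (u k) * f k x)" by (rule g_exp) fact+
    also have "\<dots> = (\<Sum>k\<in>I. if k = i then g j (u i) * f i x else 0)"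
      by (intro sum.cong) (simp_all add: other)
    finally show ?thesis using i fin by simp
  qed
  have "0 < g j (u i)" using g_nonneg[OF i j(1)] j(2) by (simp add: less_le)
  then show ?thesis
    using j(1) by (intro bexI[of _ j] exI[of _ "1 / g j (u i)"]) (simp_all add: eq)
qed

text \<open>
  The cones of directions at \<open>p\<close> coincide because a short multiple of any direction stays
  inside the neighbourhood.
\<close>

lemma facets_proportional:
  fixes F :: "'i \<Rightarrow> point \<Rightarrow> real" and G :: "'j \<Rightarrow> point \<Rightarrow> real"
  assumes fin: "finite I" "finite J"
    and aff: "\<And>i. i \<in> I \<Longrightarrow> int_affine N (F i)" "\<And>j. j \<in> J \<Longrightarrow> int_affine N (G j)"
    and zero: "\<And>i. i \<in> I \<Longrightarrow> F i p = 0" "\<And>j. j \<in> J \<Longrightarrow> G j p = 0"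
    and u: "\<And>i. i \<in> I \<Longrightarrow> u i \<in> Rn N"
      "\<And>i k. i \<in> I \<Longrightarrow> k \<in> I \<Longrightarrow> lin_part (F k) (u i) = (if k = i then 1 else 0)"
    and v: "\<And>j. j \<in> J \<Longrightarrow> v j \<in> Rn N"
      "\<And>j k. j \<in> J \<Longrightarrow> k \<in> J \<Longrightarrow> lin_part (G k) (v j) = (if k = j then 1 else 0)"
    and U: "openin (Euclidean_space N) U" "p \<in> U"
    and germ: "\<And>x. x \<in> U \<Longrightarrow> (\<forall>i\<in>I. 0 \<le> F i x) \<longleftrightarrow> (\<forall>j\<in>J. 0 \<le> G j x)"
    and i: "i \<in> I"
  shows "\<exists>j\<in>J. \<exists>c>0. \<forall>x\<in>Rn N. F i x = c * G j x"
proof -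
  have p: "p \<in> Rn N" using U openin_subset by fastforce
  have cone: "(\<forall>i\<in>I. 0 \<le> lin_part (F i) x) \<longleftrightarrow> (\<forall>j\<in>J. 0 \<le> lin_part (G j) x)"
    if x: "x \<in> Rn N" for x
  proof -
    obtain t where t: "t > 0" "p + t *\<^sub>R x \<in> U" using openin_ray[OF U x] by blast
    have "(\<forall>i\<in>I. 0 \<le> F i (p + t *\<^sub>R x)) \<longleftrightarrow> (\<forall>i\<in>I. 0 \<le> lin_part (F i) x)"
      using t(1) by (intro ball_cong) (auto simp: int_affine_along_line[OF aff(1)] zero zero_le_mult_iff)
    moreover have "(\<forall>j\<in>J. 0 \<le> G j (p + t *\<^sub>R x)) \<longleftrightarrow> (\<forall>j\<in>J. 0 \<le> lin_part (G j) x)"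
      using t(1) by (intro ball_cong) (auto simp: int_affine_along_line[OF aff(2)] zero zero_le_mult_iff)
    ultimately show ?thesis using germ t(2) by blast
  qed
  obtain j c where jc: "j \<in> J" "c > 0" "\<forall>x\<in>Rn N. lin_part (F i) x = c * lin_part (G j) x"
    using dual_cones_proportional[of I J "\<lambda>i. lin_part (F i)" "\<lambda>j. lin_part (G j)" "Rn N" u v i]
      fin linear_lin_part aff subspace_Rn u v cone i by blast
  have "F i x = c * G j x" if "x \<in> Rn N" for x
    using jc(3) lin_part_diff[of N "F i" x p] lin_part_diff[of N "G j" x p]
      aff zero i jc(1) subspace_diff[OF subspace_Rn that p] by auto
  then show ?thesis using jc by blast
qed

text \<open>
  A corner chart without its remaining coordinates and without an order of the first \<open>s\<close>: \<open>H\<close>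
  is a set of functions with an integral dual family \<open>e\<close>, which expresses linear independence and
  primitivity at once. Unlike a chart, such a set is unique, and restricting it to the functions
  that vanish at a nearby point gives the set belonging to that point.
\<close>

definition local_facets :: "nat \<Rightarrow> point set \<Rightarrow> point \<Rightarrow> (point \<Rightarrow> real) set \<Rightarrow> bool"
  where "local_facets N Q p H \<longleftrightarrow>
    finite H \<and> (\<forall>h\<in>H. int_affine N h \<and> h p = 0) \<and>
    (\<exists>e. \<forall>h\<in>H. e h \<in> Zn N \<and> (\<forall>g\<in>H. lin_part g (e h) = (if g = h then 1 else 0))) \<and>
    (\<exists>U. openin (Euclidean_space N) U \<and> p \<in> U \<and> Q \<inter> U = {x \<in> U. \<forall>h\<in>H. 0 \<le> h x})"

lemma local_facetsE:
  assumes "local_facets N Q p H"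
  obtains e U where "finite H" "\<forall>h\<in>H. int_affine N h" "\<forall>h\<in>H. h p = 0" "\<forall>h\<in>H. e h \<in> Zn N"
    "\<forall>h\<in>H. \<forall>g\<in>H. lin_part g (e h) = (if g = h then 1 else 0)"
    "openin (Euclidean_space N) U" "p \<in> U" "Q \<inter> U = {x \<in> U. \<forall>h\<in>H. 0 \<le> h x}"
  using assms unfolding local_facets_def by blast

lemma int_mult_one_pos:
  fixes a b :: real
  assumes "a \<in> \<int>" "b \<in> \<int>" "a * b = 1" "a > 0" shows "a = 1"
proof -
  obtain m n where "a = of_int m" "b = of_int n" using assms by (auto elim!: Ints_cases)
  with assms show ?thesis
    by (metis of_int_0_less_iff of_int_1 of_int_eq_iff of_int_mult zmult_eq_1_iff not_one_less_zero less_minus_one_simps(1) neg_0_less_iff_less less_asym')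
qed

text \<open>
  Evaluating the linear parts of \<open>h = c g\<close> at the dual vectors of \<open>h\<close> and of \<open>g\<close> shows that \<open>1 / c\<close> and \<open>c\<close> are both
  integers.
\<close>

lemma local_facets_subset:
  assumes H: "local_facets N Q p H" and G: "local_facets N Q p G"
  shows "H \<subseteq> G"
proof
  fix h assume h: "h \<in> H"
  obtain e U where Ha: "finite H" "\<forall>h\<in>H. int_affine N h" "\<forall>h\<in>H. h p = 0"
    and e: "\<forall>h\<in>H. e h \<in> Zn N" "\<forall>h\<in>H. \<forall>g\<in>H. lin_part g (e h) = (if g = h then 1 else 0)"
    and U: "openin (Euclidean_space N) U" "p \<in> U" "Q \<inter> U = {x \<in> U. \<forall>h\<in>H. 0 \<le> h x}"
    using H by (rule local_facetsE)
  obtain d V where Ga: "finite G" "\<forall>h\<in>G. int_affine N h" "\<forall>h\<in>G. h p = 0"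
    and d: "\<forall>h\<in>G. d h \<in> Zn N" "\<forall>h\<in>G. \<forall>g\<in>G. lin_part g (d h) = (if g = h then 1 else 0)"
    and V: "openin (Euclidean_space N) V" "p \<in> V" "Q \<inter> V = {x \<in> V. \<forall>h\<in>G. 0 \<le> h x}"
    using G by (rule local_facetsE)
  have UV: "openin (Euclidean_space N) (U \<inter> V)" "p \<in> U \<inter> V" using U V by blast+
  have germ: "(\<forall>i\<in>H. 0 \<le> id i x) \<longleftrightarrow> (\<forall>j\<in>G. 0 \<le> id j x)" if "x \<in> U \<inter> V" for x
    using that U(3) V(3) by auto
  have "\<exists>g\<in>G. \<exists>c>0. \<forall>x\<in>Rn N. id h x = c * id g x"
    by (rule facets_proportional[OF Ha(1) Ga(1) _ _ _ _ _ _ _ _ UV germ h, where u = e and v = d])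
      (use Ha Ga e d in auto)
  then obtain g c where gc: "g \<in> G" "c > 0" "\<forall>x\<in>Rn N. h x = c * g x" by auto
  have aff: "int_affine N h" "int_affine N g" using Ha Ga h gc by auto
  have lin: "lin_part h x = c * lin_part g x" if "x \<in> Rn N" for x
    using bspec[OF gc(3) that] bspec[OF gc(3), of 0] by (simp add: lin_part_def Rn_iff algebra_simps)
  have "c * lin_part g (e h) = 1" using lin[of "e h"] e h by simp
  moreover have "c = lin_part h (d g)" using lin[of "d g"] d gc by simp
  moreover have "lin_part g (e h) \<in> \<int>" "lin_part h (d g) \<in> \<int>"
    using d(1) e(1) h gc(1) by (auto intro!: lin_part_Ints[OF aff(1)] lin_part_Ints[OF aff(2)])
  ultimately have "c = 1" using int_mult_one_pos[of c "lin_part g (e h)"] gc(2) by simp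
  then have "h = g" using gc(3) by (intro int_affine_eqI[OF aff]) simp
  then show "h \<in> G" using gc by simp
qed

lemma local_facets_unique: "local_facets N Q p H \<Longrightarrow> local_facets N Q p G \<Longrightarrow> H = G"
  by (simp add: local_facets_subset subset_antisym)

lemma int_affine_aff_coord: 
  assumes "A \<in> carrier_mat N N" shows "int_affine N (aff_coord A b i)"
  using assms unfolding int_affine_def aff_coord_def lin_coord_def
  by (intro exI[of _ "\<lambda>j. A $$ (i, j)"] exI[of _ "b i"]) (auto simp: fun_eq_iff)

lemma lin_part_aff_coord: "lin_part (aff_coord A b i) = lin_coord A i"
  by (auto simp: lin_part_def aff_coord_def lin_coord_def)

lemma GL_int_dual_basis:
  assumes "A \<in> GL_int N"
  obtains e where "\<And>i. e i \<in> Zn N"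
    "\<And>i j. i < N \<Longrightarrow> j < N \<Longrightarrow> lin_coord A j (e i) = (if j = i then 1 else 0)"
proof -
  have A: "A \<in> carrier_mat N N" using assms by (simp add: GL_int_def)
  obtain B where AB: "A * B = 1\<^sub>m N" "B * A = 1\<^sub>m (dim_row B)"
    using assms unfolding GL_int_def invertible_mat_def inverts_mat_def by auto
  have B: "B \<in> carrier_mat N N"
    using arg_cong[OF AB(1), of dim_col] arg_cong[OF AB(2), of dim_col] A by auto
  define e :: "nat \<Rightarrow> point" where "e i = (\<lambda>k. if k < N then of_int (B $$ (k, i)) else 0)" for i
  have "lin_coord A j (e i) = (if j = i then 1 else 0)" if "i < N" "j < N" for i j
  proof -
    have "lin_coord A j (e i) = of_int (\<Sum>k<N. A $$ (j, k) * B $$ (k, i))"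
      using A by (simp add: lin_coord_def e_def)
    also have "(\<Sum>k<N. A $$ (j, k) * B $$ (k, i)) = (A * B) $$ (j, i)"
      using A B that by (simp add: scalar_prod_def atLeast0LessThan)
    finally show ?thesis using AB that by simp
  qed
  moreover have "e i \<in> Zn N" for i by (auto simp: e_def Rn_iff)
  ultimately show ?thesis using that by blast
qed

lemma inj_on_aff_coord:
  assumes "A \<in> GL_int N" "s \<le> N" shows "inj_on (aff_coord A b) {..<s}"
proof (rule inj_onI)
  fix i j assume *: "i \<in> {..<s}" "j \<in> {..<s}" "aff_coord A b i = aff_coord A b j"
  obtain e where "\<And>i. e i \<in> Zn N"
    and e: "\<And>i j. i < N \<Longrightarrow> j < N \<Longrightarrow> lin_coord A j (e i) = (if j = i then 1 else 0)"
    using GL_int_dual_basis[OF assms(1)] by blast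
  have "lin_coord A i (e i) = lin_coord A j (e i)" using *(3) by (metis lin_part_aff_coord)
  then show "i = j" using e[of i i] e[of i j] * assms(2) by (auto split: if_splits)
qed

lemma corner_chart_local_facets:
  assumes "corner_chart N Q p s A b"
  shows "local_facets N Q p (aff_coord A b ` {..<s})"
proof -
  have A: "A \<in> GL_int N" "s \<le> N" "A \<in> carrier_mat N N"
    using assms by (auto simp: corner_chart_def GL_int_def)
  obtain e where e: "\<And>i. e i \<in> Zn N"
    "\<And>i j. i < N \<Longrightarrow> j < N \<Longrightarrow> lin_coord A j (e i) = (if j = i then 1 else 0)"
    using GL_int_dual_basis[OF A(1)] by blast
  have inj: "inj_on (aff_coord A b) {..<s}" by (rule inj_on_aff_coord[OF A(1,2)])
  define d where "d = e \<circ> inv_into {..<s} (aff_coord A b)"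
  have "d (aff_coord A b i) = e i" if "i < s" for i
    using inj that by (simp add: d_def)
  then have "\<forall>h\<in>aff_coord A b ` {..<s}. d h \<in> Zn N \<and>
      (\<forall>g\<in>aff_coord A b ` {..<s}. lin_part g (d h) = (if g = h then 1 else 0))"
    using e A(2) inj by (auto simp: lin_part_aff_coord inj_on_eq_iff)
  then have "\<exists>e. \<forall>h\<in>aff_coord A b ` {..<s}. e h \<in> Zn N \<and>
      (\<forall>g\<in>aff_coord A b ` {..<s}. lin_part g (e h) = (if g = h then 1 else 0))"
    by blast
  moreover obtain U where "openin (Euclidean_space N) U" "p \<in> U"
      "Q \<inter> U = {x \<in> U. \<forall>i<s. aff_coord A b i x \<ge> 0}"
    using assms unfolding corner_chart_def by auto
  then have "\<exists>U. openin (Euclidean_space N) U \<and> p \<in> U \<and>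
      Q \<inter> U = {x \<in> U. \<forall>h\<in>aff_coord A b ` {..<s}. 0 \<le> h x}" by force
  moreover have "finite (aff_coord A b ` {..<s})" by simp
  moreover have "\<forall>h\<in>aff_coord A b ` {..<s}. int_affine N h \<and> h p = 0"
    using assms int_affine_aff_coord[OF A(3)] unfolding corner_chart_def by auto
  ultimately show ?thesis unfolding local_facets_def by (intro conjI)
qed

lemma local_facets_nearby:
  assumes "finite H" "\<forall>h\<in>H. int_affine N h"
    and e: "\<forall>h\<in>H. h x = 0 \<longrightarrow> e h \<in> Zn N \<and>
        (\<forall>g\<in>H. g x = 0 \<longrightarrow> lin_part g (e h) = (if g = h then 1 else 0))"
    and U: "openin (Euclidean_space N) U" "x \<in> U" "Q \<inter> U = {x \<in> U. \<forall>h\<in>H. 0 \<le> h x}"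
    and x: "\<forall>h\<in>H. 0 \<le> h x"
  shows "local_facets N Q x {h \<in> H. h x = 0}"
proof -
  define V where "V = U \<inter> {y \<in> Rn N. \<forall>h\<in>{h \<in> H. h x \<noteq> 0}. 0 < h y}"
  have "x \<in> Rn N" using U openin_subset by fastforce
  have "openin (Euclidean_space N) V" unfolding V_def
    by (intro openin_Int U openin_Rn_pos[where f = "\<lambda>h. h"]) (use assms in auto)
  moreover have "x \<in> V" unfolding V_def using U x \<open>x \<in> Rn N\<close> by (auto simp: less_le)
  moreover have "Q \<inter> V = {y \<in> V. \<forall>h\<in>{h \<in> H. h x = 0}. 0 \<le> h y}"
    using U(3) unfolding V_def by (auto intro: less_imp_le)
  ultimately have "\<exists>U. openin (Euclidean_space N) U \<and> x \<in> U \<and> Q \<inter> U = {y \<in> U. \<forall>h\<in>{h \<in> H. h x = 0}. 0 \<le> h y}"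
    by blast
  moreover have "\<exists>e. \<forall>h\<in>{h \<in> H. h x = 0}. e h \<in> Zn N \<and>
      (\<forall>g\<in>{h \<in> H. h x = 0}. lin_part g (e h) = (if g = h then 1 else 0))"
    using e by (intro exI[of _ e]) auto
  moreover have "finite {h \<in> H. h x = 0}" using assms(1) by simp
  moreover have "\<forall>h\<in>{h \<in> H. h x = 0}. int_affine N h \<and> h x = 0" using assms(2) by simp
  ultimately show ?thesis unfolding local_facets_def by (intro conjI)
qed


section \<open>Facet functions of a framed polytope\<close>

definition facet_functions :: "framed \<Rightarrow> (point \<Rightarrow> real) set"
  where "facet_functions X =
    {h. \<exists>p\<in>body X. \<exists>H. local_facets (ambient_dim X) (frame X) p H \<and> h \<in> H}"

lemma framed_polytopeD:
  assumes "framed_polytope X"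
  shows "polytope (body X)" "body X \<noteq> {}" "body X \<subseteq> Rn (ambient_dim X)"
    "frame X \<subseteq> Rn (ambient_dim X)" "affine hull body X \<inter> frame X = body X" "body X \<subseteq> frame X"
    "affine hull body X \<subseteq> Rn (ambient_dim X)"
proof -
  obtain n L where *: "body X \<subseteq> Rn (ambient_dim X)" "simple_polytope n (body X)"
    "regular_rational_framing (ambient_dim X) (body X) L (frame X)"
    using assms unfolding framed_polytope_def by blast
  show "polytope (body X)" using *(2) by (simp add: simple_polytope_def)
  show "body X \<subseteq> Rn (ambient_dim X)" by fact
  show "frame X \<subseteq> Rn (ambient_dim X)" using *(3) by (simp add: regular_rational_framing_def)
  show 1: "affine hull body X \<inter> frame X = body X"
    using *(3) by (auto simp: regular_rational_framing_def)
  then show "body X \<subseteq> frame X" by blast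
  show "affine hull body X \<subseteq> Rn (ambient_dim X)"
    by (intro hull_minimal * subspace_imp_affine subspace_Rn)
  obtain B where "affine hull B = affine hull body X" "card B = n + 1"
    using *(2) unfolding simple_polytope_def has_aff_dim_def by blast
  then show "body X \<noteq> {}" by (metis affine_hull_eq_empty card.empty Suc_eq_plus1 nat.distinct(1))
qed

lemma direction_space_subset_Rn:
  assumes "L \<subseteq> Rn N" shows "direction_space L \<subseteq> Rn N"
  using assms by (auto simp: direction_space_def intro!: subspace_diff[OF subspace_Rn])

text \<open>
  Transversality to the deepest face through \<open>p\<close> allows the dual vectors of the chart to be moved
  into the direction space of the affine hull of the body.
\<close>

lemma local_facets_transversal:
  assumes "framed_polytope X" and p: "p \<in> body X"
  shows "\<exists>H d. local_facets (ambient_dim X) (frame X) p H \<and>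
    (\<forall>h\<in>H. d h \<in> direction_space (affine hull body X) \<and>
      (\<forall>g\<in>H. lin_part g (d h) = (if g = h then 1 else 0)))"
proof -
  define N Q L where "N = ambient_dim X" and "Q = frame X" and "L = affine hull body X"
  have fr: "\<forall>x0\<in>Q. \<exists>s A b. corner_chart N Q x0 s A b" "transversal N L Q" "L \<inter> Q = body X"
    using assms(1) unfolding framed_polytope_def regular_rational_framing_def N_def Q_def L_def by auto
  obtain s A b where ch: "corner_chart N Q p s A b" using fr p by blast
  have A: "A \<in> GL_int N" "s \<le> N" using ch by (auto simp: corner_chart_def)
  obtain e where e: "\<And>i. e i \<in> Zn N"
    "\<And>i j. i < N \<Longrightarrow> j < N \<Longrightarrow> lin_coord A j (e i) = (if j = i then 1 else 0)"
    using GL_int_dual_basis[OF A(1)] by blast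
  have span: "{u + v |u v. u \<in> direction_space L \<and> v \<in> Rn N \<and> (\<forall>j<s. lin_coord A j v = 0)} = Rn N"
  proof -
    have "p \<in> L \<inter> Q" using fr(3) p by simp
    with fr(2) ch have "\<forall>J\<subseteq>{..<s}. {u + v |u v. u \<in> direction_space L \<and> v \<in> Rn N \<and>
        (\<forall>j\<in>J. lin_coord A j v = 0)} = Rn N" unfolding transversal_def by blast
    from this[rule_format, of "{..<s}"] show ?thesis by (simp add: Ball_def)
  qed
  have "\<exists>u. u \<in> direction_space L \<and> (\<forall>j<s. lin_coord A j u = (if j = i then 1 else 0))"
    if i: "i < s" for i
  proof -
    have "e i \<in> {u + v |u v. u \<in> direction_space L \<and> v \<in> Rn N \<and> (\<forall>j<s. lin_coord A j v = 0)}"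
      using e(1)[of i] span by simp
    then obtain u v where uv: "e i = u + v" "u \<in> direction_space L" "\<forall>j<s. lin_coord A j v = 0" by blast
    have "lin_coord A j u = lin_coord A j (e i) - lin_coord A j v" for j
      using uv(1) by (simp add: lin_coord_def algebra_simps sum.distrib)
    then show ?thesis using uv e(2)[of i] i A(2) by (intro exI[of _ u]) auto
  qed
  then obtain u where u: "\<And>i. i < s \<Longrightarrow> u i \<in> direction_space L"
    "\<And>i j. i < s \<Longrightarrow> j < s \<Longrightarrow> lin_coord A j (u i) = (if j = i then 1 else 0)" by metis
  have inj: "inj_on (aff_coord A b) {..<s}" by (rule inj_on_aff_coord[OF A])
  define d where "d = u \<circ> inv_into {..<s} (aff_coord A b)"
  have "d (aff_coord A b i) = u i" if "i < s" for i
    using inj that by (simp add: d_def)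
  then have "\<forall>h\<in>aff_coord A b ` {..<s}. d h \<in> direction_space L \<and>
      (\<forall>g\<in>aff_coord A b ` {..<s}. lin_part g (d h) = (if g = h then 1 else 0))"
    using u inj by (auto simp: lin_part_aff_coord inj_on_eq_iff)
  then show ?thesis using corner_chart_local_facets[OF ch] unfolding N_def Q_def L_def by blast
qed

lemma facet_systems_nearby:
  assumes "local_facets N Q p H"
  shows "\<exists>U. openin (Euclidean_space N) U \<and> p \<in> U \<and>
    (\<forall>x\<in>U \<inter> Q. local_facets N Q x {h \<in> H. h x = 0})"
proof -
  obtain e U where H: "finite H" "\<forall>h\<in>H. int_affine N h" "\<forall>h\<in>H. h p = 0"
    and e: "\<forall>h\<in>H. e h \<in> Zn N" "\<forall>h\<in>H. \<forall>g\<in>H. lin_part g (e h) = (if g = h then 1 else 0)"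
    and U: "openin (Euclidean_space N) U" "p \<in> U" "Q \<inter> U = {x \<in> U. \<forall>h\<in>H. 0 \<le> h x}"
    using assms by (rule local_facetsE)
  have "local_facets N Q x {h \<in> H. h x = 0}" if "x \<in> U \<inter> Q" for x
    by (rule local_facets_nearby[OF H(1,2) _ U(1) _ U(3), where e = e]) (use e U(3) that in auto)
  then show ?thesis using U by blast
qed

lemma convex_point_on_segment:
  assumes "convex P" "p \<in> P" "q \<in> P" "0 \<le> t" "t \<le> (1::real)"
  shows "p + t *\<^sub>R (q - p) \<in> P"
proof -
  have "(1 - t) *\<^sub>R p + t *\<^sub>R q \<in> P" using assms by (intro convexD) auto
  then show ?thesis by (simp add: algebra_simps)
qed

text \<open>
  The segment from \<open>p\<close> to \<open>q\<close> starts inside the frame, and \<open>h\<close> is affine along it and vanishes at \<open>p\<close>.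
\<close>

lemma facets_nonneg:
  assumes "convex P" "P \<subseteq> Q" "P \<subseteq> Rn N" "p \<in> P" "q \<in> P" "local_facets N Q p H" "h \<in> H"
  shows "0 \<le> h q"
proof -
  obtain e U where H: "finite H" "\<forall>h\<in>H. int_affine N h" "\<forall>h\<in>H. h p = 0"
    and U: "openin (Euclidean_space N) U" "p \<in> U" "Q \<inter> U = {x \<in> U. \<forall>h\<in>H. 0 \<le> h x}"
    using assms(6) by (rule local_facetsE)
  have v: "q - p \<in> Rn N" using assms by (intro subspace_diff subspace_Rn) auto
  obtain t where t: "t > 0" "t \<le> 1" "p + t *\<^sub>R (q - p) \<in> U" using openin_ray[OF U(1,2) v] by blast
  have "p + t *\<^sub>R (q - p) \<in> P" using t assms by (intro convex_point_on_segment) auto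
  then have "p + t *\<^sub>R (q - p) \<in> Q \<inter> U" using assms(2) t(3) by blast
  then have "0 \<le> h (p + t *\<^sub>R (q - p))" using U(3) assms(7) by blast
  also have "\<dots> = t * h q"
  proof -
    have "int_affine N h" "h p = 0" using H(2,3) assms(7) by blast+
    then show ?thesis by (simp add: int_affine_along_line lin_part_diff)
  qed
  finally show ?thesis using t(1) by (simp add: zero_le_mult_iff)
qed

text \<open>
  Facets do not change along the body: a facet function at \<open>p\<close> that also vanishes at \<open>q\<close>
  vanishes on the whole segment, and the set of points of the segment at which it is a facet function
  is open and closed, since near each point the facet functions are exactly those of that point which
  still vanish.
\<close>

lemma facets_propagate:
  assumes P: "convex P" "P \<subseteq> Q" "P \<subseteq> Rn N"
    and ex: "\<And>x. x \<in> P \<Longrightarrow> \<exists>H. local_facets N Q x H"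
    and p: "p \<in> P" "local_facets N Q p H" "h \<in> H"
    and q: "q \<in> P" "h q = 0" "local_facets N Q q G"
  shows "h \<in> G"
proof -
  have h: "int_affine N h" "h p = 0" using p unfolding local_facets_def by auto
  define x where "x t = p + t *\<^sub>R (q - p)" for t :: real
  have v: "q - p \<in> Rn N" using P p q by (intro subspace_diff subspace_Rn) auto
  have xP: "x t \<in> P" if "t \<in> {0..1}" for t
    unfolding x_def using that P p q by (intro convex_point_on_segment) auto
  have hx: "h (x t) = 0" for t
    using lin_part_diff[OF h(1), of q p] h(2) q(2) by (simp add: x_def int_affine_along_line[OF h(1)])
  \<comment> \<open>Uniqueness of the local facets makes the quantifier harmless.\<close>
  define good where "good t \<longleftrightarrow> (\<forall>H. local_facets N Q (x t) H \<longrightarrow> h \<in> H)" for t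
  have "good 1"
  proof (rule connected_induction_simple[of "{0..1}" 0 1 good])
    show "good 0" unfolding good_def x_def using p(2,3) local_facets_unique by fastforce
  next
    fix t :: real assume t: "t \<in> {0..1}"
    obtain K where K: "local_facets N Q (x t) K" using ex xP[OF t] by blast
    obtain U where U: "openin (Euclidean_space N) U" "x t \<in> U"
      "\<forall>y\<in>U \<inter> Q. local_facets N Q y {h \<in> K. h y = 0}" using facet_systems_nearby[OF K] by blast
    define T where "T = {0..1} \<inter> {t. x t \<in> U}"
    have "open {t. x t \<in> U}" unfolding x_def
      by (rule openin_line_preimage[OF U(1)]) (use P p v in auto)
    then have "openin (top_of_set {0..1}) T" unfolding T_def by (rule openin_open_Int)
    moreover have "good r \<longleftrightarrow> h \<in> K" if "r \<in> T" for r
    proof -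
      have "local_facets N Q (x r) {h \<in> K. h (x r) = 0}"
        using U(3) that xP[of r] P(2) unfolding T_def by blast
      then show ?thesis unfolding good_def using hx[of r] local_facets_unique by blast
    qed
    moreover have "t \<in> T" using t U(2) by (simp add: T_def)
    ultimately show "\<exists>T. openin (top_of_set {0..1}) T \<and> t \<in> T \<and> (\<forall>x\<in>T. \<forall>y\<in>T. good x \<longrightarrow> good y)"
      by blast
  qed auto
  then show ?thesis using q(3) by (simp add: good_def x_def)
qed

lemma convex_pos_int_affine:
  assumes "int_affine N h" shows "convex {x. 0 < h x}"
  unfolding convex_alt
proof (intro ballI allI impI)
  fix x y and u :: real assume *: "x \<in> {x. 0 < h x}" "y \<in> {x. 0 < h x}" "0 \<le> u \<and> u \<le> 1"
  have "(1 - u) *\<^sub>R x + u *\<^sub>R y = x + u *\<^sub>R (y - x)" by (simp add: algebra_simps)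
  then have "h ((1 - u) *\<^sub>R x + u *\<^sub>R y) = (1 - u) * h x + u * h y"
    using int_affine_along_line[OF assms, of x u "y - x"] lin_part_diff[OF assms, of y x]
    by (simp add: algebra_simps)
  moreover have "0 < (1 - u) * h x + u * h y"
    using * by (cases "u = 0") (auto intro!: add_nonneg_pos)
  ultimately show "(1 - u) *\<^sub>R x + u *\<^sub>R y \<in> {x. 0 < h x}" by simp
qed

lemma facet_functions_at:
  assumes X: "framed_polytope X" and p: "p \<in> body X"
  shows "local_facets (ambient_dim X) (frame X) p {h \<in> facet_functions X. h p = 0}"
proof -
  note D = framed_polytopeD[OF X]
  have cv: "convex (body X)" using D(1) by (rule polytope_imp_convex)
  have ex: "\<exists>H. local_facets (ambient_dim X) (frame X) x H" if "x \<in> body X" for x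
    using local_facets_transversal[OF X that] by blast
  obtain H where H: "local_facets (ambient_dim X) (frame X) p H" using ex p by blast
  have "{h \<in> facet_functions X. h p = 0} = H"
  proof
    show "{h \<in> facet_functions X. h p = 0} \<subseteq> H"
      using facets_propagate[OF cv D(6,3) ex _ _ _ p _ H] unfolding facet_functions_def by blast
    show "H \<subseteq> {h \<in> facet_functions X. h p = 0}"
      using H p unfolding facet_functions_def local_facets_def by blast
  qed
  then show ?thesis using H by simp
qed

lemma facet_functionsD:
  assumes X: "framed_polytope X" and h: "h \<in> facet_functions X"
  shows "int_affine (ambient_dim X) h" "p \<in> body X \<Longrightarrow> 0 \<le> h p" "\<exists>p\<in>body X. h p = 0"
proof -
  note D = framed_polytopeD[OF X]
  obtain q H where q: "q \<in> body X" "local_facets (ambient_dim X) (frame X) q H" "h \<in> H"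
    using h unfolding facet_functions_def by blast
  show "int_affine (ambient_dim X) h" "\<exists>p\<in>body X. h p = 0"
    using q unfolding local_facets_def by auto
  show "0 \<le> h p" if "p \<in> body X"
    by (rule facets_nonneg[OF _ D(6,3) q(1) that q(2,3)]) (use D(1) in \<open>rule polytope_imp_convex\<close>)
qed

text \<open>
  A facet function vanishes somewhere on the body and is nonnegative on it, hence it vanishes at one
  of the finitely many points spanning the polytope, where only finitely many facet functions vanish.
\<close>

lemma finite_facet_functions:
  assumes X: "framed_polytope X" shows "finite (facet_functions X)"
proof -
  note D = framed_polytopeD[OF X]
  obtain V where V: "finite V" "body X = convex hull V" using D(1) unfolding polytope_def by blast
  have "facet_functions X \<subseteq> (\<Union>v\<in>V. {h \<in> facet_functions X. h v = 0})"
  proof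
    fix h assume h: "h \<in> facet_functions X"
    have "\<exists>v\<in>V. h v = 0"
    proof (rule ccontr)
      assume no: "\<not> ?thesis"
      have "0 < h v" if "v \<in> V" for v
        using no that facet_functionsD(2)[OF X h, of v] V(2) hull_inc[of v V convex] by fastforce
      then have "convex hull V \<subseteq> {x. 0 < h x}"
        by (intro hull_minimal convex_pos_int_affine[OF facet_functionsD(1)[OF X h]]) auto
      then show False using facet_functionsD(3)[OF X h] V(2) by fastforce
    qed
    then show "h \<in> (\<Union>v\<in>V. {h \<in> facet_functions X. h v = 0})" using h by blast
  qed
  moreover have "finite {h \<in> facet_functions X. h v = 0}" if "v \<in> V" for v
    using facet_functions_at[OF X, of v] that V(2) hull_inc[of v V convex]
    unfolding local_facets_def by metis
  ultimately show ?thesis using V(1) by (meson finite_UN_I finite_subset)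
qed

text \<open>
  At a point of the body the local functions cut out the frame, and the other facet functions are
  positive there, hence also nearby.
\<close>

lemma frame_eq_facets_near_body:
  assumes X: "framed_polytope X"
  obtains V where "openin (Euclidean_space (ambient_dim X)) V" "body X \<subseteq> V"
    "frame X \<inter> V = {x \<in> V. \<forall>h\<in>facet_functions X. 0 \<le> h x}"
proof -
  define N where "N = ambient_dim X"
  note D = framed_polytopeD[OF X, folded N_def] and F = facet_functionsD[OF X, folded N_def]
  have "\<exists>U. openin (Euclidean_space N) U \<and> p \<in> U \<and>
      frame X \<inter> U = {x \<in> U. \<forall>h\<in>facet_functions X. 0 \<le> h x}" if p: "p \<in> body X" for p
  proof -
    obtain e U where U: "openin (Euclidean_space N) U" "p \<in> U"
      "frame X \<inter> U = {x \<in> U. \<forall>h\<in>{h \<in> facet_functions X. h p = 0}. 0 \<le> h x}"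
      using facet_functions_at[OF X p] unfolding N_def by (rule local_facetsE)
    define W where "W = U \<inter> {y \<in> Rn N. \<forall>h\<in>{h \<in> facet_functions X. h p \<noteq> 0}. 0 < h y}"
    have "openin (Euclidean_space N) W" unfolding W_def
      by (intro openin_Int U openin_Rn_pos[where f = "\<lambda>h. h"])
        (use F(1) finite_facet_functions[OF X] in auto)
    moreover have "p \<in> W" unfolding W_def using U F(2)[OF _ p] D(3) p by (auto simp: less_le)
    moreover have "frame X \<inter> W = {x \<in> W. \<forall>h\<in>facet_functions X. 0 \<le> h x}"
    proof -
      have "0 \<le> h y" if "y \<in> W" "\<forall>h\<in>{h \<in> facet_functions X. h p = 0}. 0 \<le> h y"
        "h \<in> facet_functions X" for y h
        using that unfolding W_def by (cases "h p = 0") (auto intro: less_imp_le)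
      then show ?thesis using U(3) unfolding W_def by blast
    qed
    ultimately show ?thesis by blast
  qed
  note cover = this
  define \<U> where "\<U> = {U. openin (Euclidean_space N) U \<and>
    frame X \<inter> U = {x \<in> U. \<forall>h\<in>facet_functions X. 0 \<le> h x}}"
  have "openin (Euclidean_space (ambient_dim X)) (\<Union>\<U>)"
    unfolding \<U>_def N_def by (rule openin_Union) simp
  moreover have "body X \<subseteq> \<Union>\<U>" using cover unfolding \<U>_def by blast
  moreover have "frame X \<inter> \<Union>\<U> = {x \<in> \<Union>\<U>. \<forall>h\<in>facet_functions X. 0 \<le> h x}"
    unfolding \<U>_def by blast
  ultimately show ?thesis using that by blast
qed

lemma facet_functions_transversal:
  assumes X: "framed_polytope X" and p: "p \<in> body X"
  shows "\<exists>d. \<forall>h\<in>{h \<in> facet_functions X. h p = 0}. d h \<in> direction_space (affine hull body X) \<and>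
    (\<forall>g\<in>{h \<in> facet_functions X. h p = 0}. lin_part g (d h) = (if g = h then 1 else 0))"
proof -
  obtain H d where H: "local_facets (ambient_dim X) (frame X) p H"
    and d: "\<forall>h\<in>H. d h \<in> direction_space (affine hull body X) \<and>
      (\<forall>g\<in>H. lin_part g (d h) = (if g = h then 1 else 0))"
    using local_facets_transversal[OF X p] by blast
  have "H = {h \<in> facet_functions X. h p = 0}"
    using local_facets_unique[OF H facet_functions_at[OF X p]] .
  from d[unfolded this] show ?thesis by (rule exI[of _ d])
qed


section \<open>Pure sublattices\<close>

text \<open>
  A primitive integer vector therefore takes the value \<open>1\<close> under some integral functional.
\<close>

lemma bezout_finite_family:
  fixes a :: "nat \<Rightarrow> int"
  shows "\<exists>\<phi>. (\<Sum>k<M. \<phi> k * a k) = Gcd (a ` {..<M})"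
proof (induction M)
  case 0
  then show ?case by simp
next
  case (Suc M)
  then obtain \<phi> where \<phi>: "(\<Sum>k<M. \<phi> k * a k) = Gcd (a ` {..<M})" by blast
  obtain u v where uv: "u * a M + v * Gcd (a ` {..<M}) = gcd (a M) (Gcd (a ` {..<M}))"
    using bezout_int by blast
  have "(\<Sum>k<Suc M. (if k = M then u else v * \<phi> k) * a k) = u * a M + v * (\<Sum>k<M. \<phi> k * a k)"
    by (simp add: sum_distrib_left mult.assoc)
  also have "\<dots> = Gcd (a ` {..<Suc M})" using \<phi> uv by (simp add: lessThan_Suc)
  finally show ?case by (rule exI[of _ "\<lambda>k. if k = M then u else v * \<phi> k"])
qed

text \<open>
  The hypothesis says that the family is independent (the case \<open>q = 0\<close>) and that the sublattice
  spanned by it has torsion-free quotient. One step of Gaussian elimination preserves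
  it: the last vector is primitive, some functional \<open>\<phi>0\<close> takes the value \<open>1\<close> on it, and the other
  vectors can be modified by multiples of the last one so as to lie in the kernel of \<open>\<phi>0\<close>.
\<close>

lemma pure_family_has_dual:
  fixes a :: "nat \<Rightarrow> nat \<Rightarrow> int"
  assumes "\<And>q c. (\<And>k. k < M \<Longrightarrow> q dvd (\<Sum>j<n. c j * a j k)) \<Longrightarrow> \<forall>j<n. q dvd c j"
  shows "\<exists>\<phi>. \<forall>i<n. \<forall>j<n. (\<Sum>k<M. \<phi> i k * a j k) = (if i = j then 1 else 0)"
  using assms
proof (induction n arbitrary: a)
  case 0
  then show ?case by simp
next
  case (Suc n)
  define dot :: "(nat \<Rightarrow> int) \<Rightarrow> (nat \<Rightarrow> int) \<Rightarrow> int" where "dot \<phi> b = (\<Sum>k<M. \<phi> k * b k)" for \<phi> b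
  have dot_diff1: "dot (\<lambda>k. \<phi> k - r * \<psi> k) b = dot \<phi> b - r * dot \<psi> b" for \<phi> \<psi> r b
    by (simp add: dot_def left_diff_distrib sum_subtractf sum_distrib_left mult.assoc)
  have dot_diff2: "dot \<phi> (\<lambda>k. b k - r * d k) = dot \<phi> b - r * dot \<phi> d" for \<phi> b r d
    by (simp add: dot_def right_diff_distrib sum_subtractf sum_distrib_left mult.left_commute)
  have dot_sum: "dot (\<lambda>k. \<phi> k - (\<Sum>i<n. r i * \<psi> i k)) b = dot \<phi> b - (\<Sum>i<n. r i * dot (\<psi> i) b)" for \<phi> r \<psi> b
    by (simp add: dot_def left_diff_distrib sum_subtractf sum_distrib_left sum_distrib_right mult.assoc)
      (rule sum.swap)
  have "Gcd (a n ` {..<M}) dvd (\<Sum>j<Suc n. (if j = n then 1 else 0) * a j k)" if "k < M" for k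
    using that by (simp add: Gcd_dvd)
  from Suc.prems[OF this] have "Gcd (a n ` {..<M}) dvd 1" by auto
  moreover have "Gcd (a n ` {..<M}) \<ge> 0" by simp
  ultimately have "Gcd (a n ` {..<M}) = 1" by simp
  then obtain \<phi>0 where \<phi>0: "dot \<phi>0 (a n) = 1" using bezout_finite_family[where M = M and a = "a n"] unfolding dot_def by auto
  define a' where "a' j k = a j k - dot \<phi>0 (a j) * a n k" for j k
  have "\<exists>\<psi>. \<forall>i<n. \<forall>j<n. (\<Sum>k<M. \<psi> i k * a' j k) = (if i = j then 1 else 0)"
  proof (rule Suc.IH)
    fix q :: int and c assume q: "\<And>k. k < M \<Longrightarrow> q dvd (\<Sum>j<n. c j * a' j k)"
    \<comment> \<open>The same combination, rewritten in terms of the original vectors.\<close>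
    define c' where "c' j = (if j = n then - (\<Sum>j<n. c j * dot \<phi>0 (a j)) else c j)" for j
    have "(\<Sum>j<Suc n. c' j * a j k) = (\<Sum>j<n. c j * a' j k)" for k
      by (simp add: c'_def a'_def right_diff_distrib sum_subtractf sum_distrib_right mult.assoc)
    with q have "\<And>k. k < M \<Longrightarrow> q dvd (\<Sum>j<Suc n. c' j * a j k)" by simp
    from Suc.prems[OF this] have "q dvd c' j" if "j < n" for j using that by simp
    then show "\<forall>j<n. q dvd c j" by (metis c'_def less_irrefl)
  qed
  then obtain \<psi> where \<psi>: "\<And>i j. i < n \<Longrightarrow> j < n \<Longrightarrow> dot (\<psi> i) (a' j) = (if i = j then 1 else 0)"
    unfolding dot_def by blast
  have \<phi>0': "dot \<phi>0 (a' j) = 0" for j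
    unfolding a'_def by (simp add: dot_diff2 \<phi>0)
  \<comment> \<open>The functionals from the induction hypothesis, corrected so as to vanish on the last vector.\<close>
  define \<psi>' where "\<psi>' i k = \<psi> i k - dot (\<psi> i) (a n) * \<phi>0 k" for i k
  have n': "dot (\<psi>' i) (a n) = 0" for i
    unfolding \<psi>'_def by (simp add: dot_diff1 \<phi>0)
  have j': "dot (\<psi>' i) (a j) = (if i = j then 1 else 0)" if "i < n" "j < n" for i j
  proof -
    have "dot (\<psi>' i) (a' j) = (if i = j then 1 else 0)"
      unfolding \<psi>'_def using that by (simp add: dot_diff1 \<phi>0' \<psi>)
    then show ?thesis unfolding a'_def by (simp add: dot_diff2 n')
  qed
  define \<phi> where "\<phi> i k = (if i = n then \<phi>0 k - (\<Sum>i<n. dot \<phi>0 (a i) * \<psi>' i k) else \<psi>' i k)" for i k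
  have last: "dot (\<phi> n) b = dot \<phi>0 b - (\<Sum>i<n. dot \<phi>0 (a i) * dot (\<psi>' i) b)" for b
    unfolding \<phi>_def by (simp add: dot_sum)
  have first: "\<phi> i = \<psi>' i" if "i < n" for i using that by (auto simp: \<phi>_def)
  have "dot (\<phi> i) (a j) = (if i = j then 1 else 0)" if "i < Suc n" "j < Suc n" for i j
  proof (cases "i = n")
    case True
    show ?thesis
    proof (cases "j = n")
      case True
      then show ?thesis by (simp add: \<open>i = n\<close> last n' \<phi>0)
    next
      case False
      then have "j < n" using that by simp
      then have "(\<Sum>i<n. dot \<phi>0 (a i) * dot (\<psi>' i) (a j)) = (\<Sum>i<n. if i = j then dot \<phi>0 (a i) else 0)"
        by (intro sum.cong) (auto simp: j')
      then show ?thesis using \<open>j < n\<close> by (simp add: \<open>i = n\<close> last)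
    qed
  next
    case False
    then have "i < n" using that by simp
    then show ?thesis using that by (cases "j = n") (simp_all add: first n' j')
  qed
  then show ?case unfolding dot_def by blast
qed

lemma carrier_int_lattice: "carrier (int_lattice N) = Zn N"
  by (simp add: int_lattice_def)

lemma comm_group_int_lattice: "comm_group (int_lattice N)"
proof (rule comm_groupI)
  fix x assume "x \<in> carrier (int_lattice N)"
  then show "\<exists>y\<in>carrier (int_lattice N). y \<otimes>\<^bsub>int_lattice N\<^esub> x = \<one>\<^bsub>int_lattice N\<^esub>"
    by (intro bexI[of _ "- x"]) (auto simp: int_lattice_def Rn_iff)
qed (auto simp: int_lattice_def Rn_iff algebra_simps)

lemma int_lattice_pow: "x [^]\<^bsub>int_lattice N\<^esub> (k::nat) = real k *\<^sub>R x"
  by (induction k) (auto simp: int_lattice_def nat_pow_def algebra_simps fun_eq_iff)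

lemma torsion_free_quotient_iff:
  assumes "subgroup \<Lambda> (int_lattice M)"
  shows "torsion_free (int_lattice M Mod \<Lambda>) \<longleftrightarrow>
    (\<forall>u\<in>Zn M. \<forall>k::nat. k > 0 \<and> real k *\<^sub>R u \<in> \<Lambda> \<longrightarrow> u \<in> \<Lambda>)"
proof -
  interpret comm_group "int_lattice M" by (rule comm_group_int_lattice)
  interpret normal \<Lambda> "int_lattice M" using subgroup_imp_normal[OF assms] .
  have coset: "\<Lambda> #>\<^bsub>int_lattice M\<^esub> u = \<Lambda> \<longleftrightarrow> u \<in> \<Lambda>" if "u \<in> Zn M" for u
    using that coset_join1[of \<Lambda> u] coset_join2[of u \<Lambda>] assms subgroup.subset[OF assms]
    by (auto simp: carrier_int_lattice)
  have scale: "real k *\<^sub>R u \<in> Zn M" if "u \<in> Zn M" for k u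
    using that by (auto simp: Rn_iff)
  show ?thesis
    unfolding torsion_free_def carrier_FactGroup carrier_int_lattice
    by (simp add: FactGroup_pow carrier_int_lattice int_lattice_pow coset scale del: mem_Collect_eq)
qed

definition std_vec :: "nat \<Rightarrow> point"
  where "std_vec j = (\<lambda>i. if i = j then 1 else 0)"

lemma std_vec_expansion: "x \<in> Rn N \<Longrightarrow> x = (\<Sum>j<N. x j *\<^sub>R std_vec j)"
  by (auto simp: fun_eq_iff std_vec_def Rn_iff if_distrib[of "\<lambda>z. _ * z"] cong: if_cong)

text \<open>
  The translation in the definition of an integral affine embedding can be removed: the conditions
  hold for the linear part.
\<close>

lemma integral_affine_embedding_lattice:
  assumes "integral_affine_embedding N M \<eta>"
  obtains f c where "linear f" "\<And>x. x \<in> Rn N \<Longrightarrow> \<eta> x = f x + c" "inj_on f (Rn N)"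
    "f ` Rn N \<subseteq> Rn M" "c \<in> Rn M" "f ` Zn N \<subseteq> Zn M"
    "\<And>u k. u \<in> Zn M \<Longrightarrow> k > 0 \<Longrightarrow> real k *\<^sub>R u \<in> f ` Zn N \<Longrightarrow> u \<in> f ` Zn N"
proof -
  from assms obtain f c t where aff: "\<eta> ` Rn N \<subseteq> Rn M" and f: "linear f" "\<forall>x\<in>Rn N. \<eta> x = f x + c"
    and inj: "inj_on \<eta> (Rn N)" and "t \<in> Rn M"
    and sub: "subgroup ((\<lambda>z. \<eta> z + t) ` Zn N) (int_lattice M)"
    and tf: "torsion_free (int_lattice M Mod ((\<lambda>z. \<eta> z + t) ` Zn N))"
    unfolding integral_affine_embedding_def affine_map_def Let_def carrier_int_lattice by blast
  have z0: "0 \<in> Rn N" "0 \<in> Zn N" by (auto simp: Rn_iff)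
  have c: "c \<in> Rn M" using aff f z0 linear_0[OF f(1)] by fastforce
  have fR: "f x \<in> Rn M" if "x \<in> Rn N" for x
  proof -
    have "f x + c \<in> Rn M" using aff f(2) that by force
    from subspace_diff[OF subspace_Rn this c] show ?thesis by simp
  qed
  have finj: "inj_on f (Rn N)" using inj f(2) by (simp add: inj_on_def)
  \<comment> \<open>The translated image contains \<open>0\<close>, so it is the image under the linear part.\<close>
  have "0 \<in> (\<lambda>z. \<eta> z + t) ` Zn N"
    using subgroup.one_closed[OF sub] by (simp add: int_lattice_def)
  then obtain z where z: "z \<in> Zn N" "0 = \<eta> z + t" by (rule imageE)
  then have ct: "c + t = - f z" using f(2) by (simp add: eq_neg_iff_add_eq_0 ac_simps)
  have shift: "\<eta> w + t = f (w - z)" if "w \<in> Zn N" for w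
    using that f(2) ct linear_diff[OF f(1), of w z] by (simp add: add.assoc)
  have cl: "w - z \<in> Zn N" "w + z \<in> Zn N" if "w \<in> Zn N" for w
    using that z(1) subspace_diff[OF subspace_Rn, of w _ z] subspace_add[OF subspace_Rn, of w _ z] by simp_all
  have \<Lambda>: "(\<lambda>z. \<eta> z + t) ` Zn N = f ` Zn N"
  proof
    show "(\<lambda>z. \<eta> z + t) ` Zn N \<subseteq> f ` Zn N"
      by (intro image_subsetI) (simp only: shift cl(1) imageI)
    show "f ` Zn N \<subseteq> (\<lambda>z. \<eta> z + t) ` Zn N"
    proof (rule image_subsetI)
      fix w assume w: "w \<in> Zn N"
      have "f w = \<eta> (w + z) + t" using shift[OF cl(2)[OF w]] by simp
      then show "f w \<in> (\<lambda>z. \<eta> z + t) ` Zn N" using cl(2)[OF w] by (rule image_eqI)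
    qed
  qed
  show ?thesis
  proof (rule that[of f c])
    show "f ` Zn N \<subseteq> Zn M" using subgroup.subset[OF sub] unfolding \<Lambda> carrier_int_lattice .
    show "u \<in> f ` Zn N" if "u \<in> Zn M" "k > 0" "real k *\<^sub>R u \<in> f ` Zn N" for u k
      using tf torsion_free_quotient_iff[OF sub] that unfolding \<Lambda> by blast
  qed (use f c fR finj in auto)
qed

text \<open>
  The images of the standard basis vectors satisfy the purity hypothesis of
  \<open>pure_family_has_dual\<close>, and the functionals obtained there are the rows of the retraction.
\<close>

lemma integral_affine_embedding_retract:
  assumes "integral_affine_embedding N M \<eta>"
  obtains S T where "int_affine_map N M S" "int_affine_map M N T"
    "\<And>x. x \<in> Rn N \<Longrightarrow> S x = \<eta> x" "\<And>x. x \<in> Rn N \<Longrightarrow> T (S x) = x"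
proof -
  obtain f c where f: "linear f" "\<And>x. x \<in> Rn N \<Longrightarrow> \<eta> x = f x + c" "inj_on f (Rn N)"
    "f ` Rn N \<subseteq> Rn M" "c \<in> Rn M" "f ` Zn N \<subseteq> Zn M"
    and pure: "\<And>u k. u \<in> Zn M \<Longrightarrow> k > 0 \<Longrightarrow> real k *\<^sub>R u \<in> f ` Zn N \<Longrightarrow> u \<in> f ` Zn N"
    using integral_affine_embedding_lattice[OF assms] by blast
  define a where "a j k = \<lfloor>f (std_vec j) k\<rfloor>" for j k
  have unit: "std_vec j \<in> Zn N" if "j < N" for j using that by (auto simp: std_vec_def Rn_iff)
  have a: "f (std_vec j) k = of_int (a j k)" if "j < N" for j k
    using f(6) unit[OF that] unfolding a_def by (auto simp: image_subset_iff)
  have fx: "f x k = (\<Sum>j<N. of_int (a j k) * x j)" if "x \<in> Rn N" for x k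
  proof -
    have "f x = f (\<Sum>j<N. x j *\<^sub>R std_vec j)" by (rule arg_cong[OF std_vec_expansion[OF that]])
    then have "f x = (\<Sum>j<N. x j *\<^sub>R f (std_vec j))"
      by (simp only: linear_sum[OF f(1)] linear_scale[OF f(1)])
    then show ?thesis by (simp add: a mult.commute)
  qed
  have "\<exists>\<phi>. \<forall>i<N. \<forall>j<N. (\<Sum>k<M. \<phi> i k * a j k) = (if i = j then 1 else 0)"
  proof (rule pure_family_has_dual)
    fix q :: int and c :: "nat \<Rightarrow> int" assume q: "\<And>k. k < M \<Longrightarrow> q dvd (\<Sum>j<N. c j * a j k)"
    define z :: point where "z j = (if j < N then of_int (c j) else 0)" for j
    have z: "z \<in> Zn N" by (auto simp: z_def Rn_iff)
    have fz: "f z k = of_int (\<Sum>j<N. c j * a j k)" for k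
      using fx[of z k] z by (simp add: z_def mult.commute)
    have fzM: "f z \<in> Rn M" using f(4) z by auto
    show "\<forall>j<N. q dvd c j"
    proof (cases "q = 0")
      case True
      have "f z k = 0" for k using q[of k] fz[of k] fzM True by (cases "k < M") (auto simp: Rn_iff)
      then have "f z = f 0" using linear_0[OF f(1)] by (auto simp: fun_eq_iff)
      then have z0: "z = 0" using f(3) z by (auto simp: inj_on_def Rn_iff)
      have "c j = 0" if j: "j < N" for j
      proof -
        have "z j = 0" by (simp add: z0)
        then show ?thesis using j by (simp add: z_def)
      qed
      then show ?thesis by simp
    next
      case False
      \<comment> \<open>The combination divided by \<open>q\<close> is a lattice vector, so purity applies to it.\<close>
      define u where "u = (1 / of_int \<bar>q\<bar>) *\<^sub>R f z"
      have "u k \<in> \<int>" for k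
      proof (cases "k < M")
        case True
        then obtain r where "(\<Sum>j<N. c j * a j k) = \<bar>q\<bar> * r" using q[of k] by (metis abs_dvd_iff dvdE)
        then have "u k = of_int r" using False fz[of k] by (simp add: u_def flip: of_int_abs)
        then show ?thesis by simp
      qed (use fzM in \<open>auto simp: u_def Rn_iff\<close>)
      then have "u \<in> Zn M" using fzM by (auto simp: u_def Rn_iff)
      moreover have qu: "real (nat \<bar>q\<bar>) *\<^sub>R u = f z" using False by (auto simp: u_def fun_eq_iff)
      ultimately obtain w where w: "w \<in> Zn N" "u = f w" using pure[of u "nat \<bar>q\<bar>"] z False by auto
      have "f (real (nat \<bar>q\<bar>) *\<^sub>R w) = f z" using qu w(2) by (simp only: linear_scale[OF f(1)])
      moreover have "real (nat \<bar>q\<bar>) *\<^sub>R w \<in> Rn N" using w(1) by (simp add: subspace_scale[OF subspace_Rn])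
      ultimately have eq: "real (nat \<bar>q\<bar>) *\<^sub>R w = z" using f(3) z by (auto simp: inj_on_def)
      show ?thesis
      proof (intro allI impI)
        fix j assume j: "j < N"
        obtain r where "w j = of_int r" using w(1) by (auto elim!: Ints_cases)
        then have "of_int (c j) = real_of_int (\<bar>q\<bar> * r)" using fun_cong[OF eq, of j] j by (simp add: z_def)
        then have "c j = \<bar>q\<bar> * r" by linarith
        then show "q dvd c j" by simp
      qed
    qed
  qed
  then obtain \<phi> where \<phi>: "\<And>i j. i < N \<Longrightarrow> j < N \<Longrightarrow> (\<Sum>k<M. \<phi> i k * a j k) = (if i = j then 1 else 0)"
    by blast
  define S where "S x = (\<lambda>k. (\<Sum>j<N. of_int (a j k) * x j) + c k)" for x :: point
  define T where "T y = (\<lambda>i. if i < N then (\<Sum>k<M. of_int (\<phi> i k) * y k) + - (\<Sum>k<M. of_int (\<phi> i k) * c k) else 0)" for y :: point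
  have S\<eta>: "S x = \<eta> x" if "x \<in> Rn N" for x
    using f(2)[OF that] fx[OF that] by (auto simp: S_def)
  have S0: "S x \<in> Rn M" for x
  proof -
    have "S x = S (trunc N x)" by (simp add: S_def trunc_def)
    also have "\<dots> = f (trunc N x) + c" using S\<eta> f(2) by simp
    finally show ?thesis using f(4,5) subspace_add[OF subspace_Rn] by (auto simp: image_subset_iff)
  qed
  show ?thesis
  proof (rule that)
    show "int_affine_map N M S" unfolding int_affine_map_def
      using S0 by (auto simp: S_def int_affine_def)
    show "int_affine_map M N T" unfolding int_affine_map_def
    proof (intro conjI allI)
      show "int_affine M (\<lambda>x. T x i)" for i
      proof (cases "i < N")
        case True
        then have "(\<lambda>x. T x i) = (\<lambda>x. (\<Sum>k<M. of_int (\<phi> i k) * x k) + - (\<Sum>k<M. of_int (\<phi> i k) * c k))"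
          by (simp add: T_def)
        then show ?thesis unfolding int_affine_def by (intro exI)
      qed (simp add: T_def)
    qed (simp add: T_def Rn_iff)
    show "T (S x) = x" if x: "x \<in> Rn N" for x
    proof
      fix i show "T (S x) i = x i"
      proof (cases "i < N")
        case True
        have "T (S x) i = (\<Sum>k<M. \<Sum>j<N. of_int (\<phi> i k * a j k) * x j)"
          using True by (simp add: T_def S_def distrib_left sum.distrib sum_distrib_left mult.assoc)
        also have "\<dots> = (\<Sum>j<N. of_int (\<Sum>k<M. \<phi> i k * a j k) * x j)"
          by (subst sum.swap) (simp add: sum_distrib_right)
        also have "\<dots> = (\<Sum>j<N. if j = i then x j else 0)"
          using True by (intro sum.cong) (auto simp: \<phi> simp del: of_int_sum)
        finally show ?thesis using True by simp
      qed (use x in \<open>simp add: T_def Rn_iff\<close>)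
    qed
  qed (rule S\<eta>)
qed


section \<open>Integral equivalence of framed polytopes\<close>

definition commensurable_on :: "'a set \<Rightarrow> ('a \<Rightarrow> real) \<Rightarrow> ('a \<Rightarrow> real) \<Rightarrow> bool"
  where "commensurable_on P f g \<longleftrightarrow> (\<exists>a b::nat. a > 0 \<and> b > 0 \<and> (\<forall>p\<in>P. real a * f p = real b * g p))"

text \<open>
  The maps \<open>S\<close> and \<open>T\<close> say that the integral affine functions of the two ambient spaces restrict
  to the same functions on the common body. The facets have to be compared separately and over the
  rational numbers: real proportionality holds for any bijection of the bodies by affine maps, but it
  is too weak to find a common framing.
\<close>

definition facet_equiv :: "framed \<Rightarrow> framed \<Rightarrow> bool"
  where "facet_equiv X Y \<longleftrightarrow> (\<exists>S T.
    int_affine_map (ambient_dim X) (ambient_dim Y) S \<and> int_affine_map (ambient_dim Y) (ambient_dim X) T \<and>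
    S ` body X = body Y \<and> (\<forall>p\<in>body X. T (S p) = p) \<and>
    (\<forall>h\<in>facet_functions X. \<exists>g\<in>facet_functions Y. commensurable_on (body X) h (\<lambda>p. g (S p))) \<and>
    (\<forall>g\<in>facet_functions Y. \<exists>h\<in>facet_functions X. commensurable_on (body X) h (\<lambda>p. g (S p))))"

lemma commensurable_onE:
  assumes "commensurable_on P f g"
  obtains a b :: nat where "a > 0" "b > 0" "\<forall>p\<in>P. real a * f p = real b * g p"
  using assms unfolding commensurable_on_def by (elim exE conjE)

lemma commensurable_onI:
  assumes "a > 0" "b > 0" "\<And>p. p \<in> P \<Longrightarrow> real a * f p = real b * g p"
  shows "commensurable_on P f g"
  unfolding commensurable_on_def
  by (rule exI[of _ a], rule exI[of _ b]) (simp add: assms)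

lemma commensurable_on_trans:
  assumes "commensurable_on P f g" "commensurable_on P g h" shows "commensurable_on P f h"
proof -
  obtain a b where ab: "a > 0" "b > 0" "\<forall>p\<in>P. real a * f p = real b * g p"
    using assms(1) by (rule commensurable_onE)
  obtain c d where cd: "c > 0" "d > 0" "\<forall>p\<in>P. real c * g p = real d * h p"
    using assms(2) by (rule commensurable_onE)
  have "real (c * a) * f p = real (b * d) * h p" if "p \<in> P" for p
  proof -
    have "real (c * a) * f p = real c * (real b * g p)" using ab(3) that by simp
    also have "\<dots> = real b * (real c * g p)" by simp
    finally show ?thesis using cd(3) that by simp
  qed
  then show ?thesis using ab cd by (intro commensurable_onI[of "c * a" "b * d"]) simp_all
qed

lemma facet_equiv_sym:
  assumes "facet_equiv X Y" shows "facet_equiv Y X"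
proof -
  obtain S T where ST: "int_affine_map (ambient_dim X) (ambient_dim Y) S"
    "int_affine_map (ambient_dim Y) (ambient_dim X) T" "S ` body X = body Y" "\<forall>p\<in>body X. T (S p) = p"
    and F: "\<forall>h\<in>facet_functions X. \<exists>g\<in>facet_functions Y. commensurable_on (body X) h (\<lambda>p. g (S p))"
    "\<forall>g\<in>facet_functions Y. \<exists>h\<in>facet_functions X. commensurable_on (body X) h (\<lambda>p. g (S p))"
    using assms unfolding facet_equiv_def by blast
  have TS: "T ` body Y = body X" "\<forall>p\<in>body Y. S (T p) = p"
  proof -
    have TSp: "T (S p) = p" if "p \<in> body X" for p using ST(4) that by blast
    then have "(\<lambda>p. T (S p)) ` body X = id ` body X" by (intro image_cong) simp_all
    then show "T ` body Y = body X" unfolding ST(3)[symmetric] by (simp add: image_image)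
    show "\<forall>p\<in>body Y. S (T p) = p"
    proof
      fix q assume "q \<in> body Y"
      then obtain p where "p \<in> body X" "q = S p" using ST(3) by blast
      then show "S (T q) = q" by (simp only: TSp)
    qed
  qed
  have comm: "commensurable_on (body Y) g (\<lambda>p. h (T p))"
    if comm: "commensurable_on (body X) h (\<lambda>p. g (S p))" for g h
  proof -
    obtain a b where ab: "a > 0" "b > 0" "\<forall>p\<in>body X. real a * h p = real b * g (S p)"
      using comm by (rule commensurable_onE)
    have "real b * g q = real a * h (T q)" if "q \<in> body Y" for q
    proof -
      have "T q \<in> body X" "S (T q) = q" using TS that by blast+
      then show ?thesis using bspec[OF ab(3), of "T q"] by simp
    qed
    then show ?thesis by (rule commensurable_onI[OF ab(2,1)])
  qed
  show ?thesis unfolding facet_equiv_def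
  proof (rule exI[of _ T], rule exI[of _ S], intro conjI)
    show "\<forall>h\<in>facet_functions Y. \<exists>g\<in>facet_functions X. commensurable_on (body Y) h (\<lambda>p. g (T p))"
      using F(2) comm by blast
    show "\<forall>g\<in>facet_functions X. \<exists>h\<in>facet_functions Y. commensurable_on (body Y) h (\<lambda>p. g (T p))"
      using F(1) comm by blast
  qed (use ST TS in blast)+
qed

lemma facet_equiv_trans:
  assumes "facet_equiv X Y" "facet_equiv Y Z" shows "facet_equiv X Z"
proof -
  obtain S T where ST: "int_affine_map (ambient_dim X) (ambient_dim Y) S"
    "int_affine_map (ambient_dim Y) (ambient_dim X) T" "S ` body X = body Y" "\<forall>p\<in>body X. T (S p) = p"
    and F: "\<forall>h\<in>facet_functions X. \<exists>g\<in>facet_functions Y. commensurable_on (body X) h (\<lambda>p. g (S p))"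
    "\<forall>g\<in>facet_functions Y. \<exists>h\<in>facet_functions X. commensurable_on (body X) h (\<lambda>p. g (S p))"
    using assms(1) unfolding facet_equiv_def by blast
  obtain S' T' where ST': "int_affine_map (ambient_dim Y) (ambient_dim Z) S'"
    "int_affine_map (ambient_dim Z) (ambient_dim Y) T'" "S' ` body Y = body Z" "\<forall>p\<in>body Y. T' (S' p) = p"
    and F': "\<forall>h\<in>facet_functions Y. \<exists>g\<in>facet_functions Z. commensurable_on (body Y) h (\<lambda>p. g (S' p))"
    "\<forall>g\<in>facet_functions Z. \<exists>h\<in>facet_functions Y. commensurable_on (body Y) h (\<lambda>p. g (S' p))"
    using assms(2) unfolding facet_equiv_def by blast
  have comm: "commensurable_on (body X) h (\<lambda>p. k (S' (S p)))"
    if "commensurable_on (body X) h (\<lambda>p. g (S p))" "commensurable_on (body Y) g (\<lambda>p. k (S' p))" for h g k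
  proof (rule commensurable_on_trans[OF that(1)])
    show "commensurable_on (body X) (\<lambda>p. g (S p)) (\<lambda>p. k (S' (S p)))"
    proof (rule commensurable_onE[OF that(2)])
      fix a b :: nat assume ab: "a > 0" "b > 0" "\<forall>p\<in>body Y. real a * g p = real b * k (S' p)"
      then show ?thesis using ST(3) by (intro commensurable_onI[OF ab(1,2)]) blast
    qed
  qed
  show ?thesis unfolding facet_equiv_def
  proof (rule exI[of _ "\<lambda>x. S' (S x)"], rule exI[of _ "\<lambda>x. T (T' x)"], intro conjI)
    show "(\<lambda>x. S' (S x)) ` body X = body Z" using ST(3) ST'(3) by (metis image_image)
    show "\<forall>p\<in>body X. T (T' (S' (S p))) = p"
    proof
      fix p assume p: "p \<in> body X"
      then have "S p \<in> body Y" using ST(3) by blast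
      then show "T (T' (S' (S p))) = p" using ST(4) ST'(4) p by simp
    qed
    show "\<forall>h\<in>facet_functions X. \<exists>g\<in>facet_functions Z. commensurable_on (body X) h (\<lambda>p. g (S' (S p)))"
      using F(1) F'(1) comm by blast
    show "\<forall>g\<in>facet_functions Z. \<exists>h\<in>facet_functions X. commensurable_on (body X) h (\<lambda>p. g (S' (S p)))"
      using F(2) F'(2) comm by blast
  qed (use ST ST' in \<open>auto intro: int_affine_map_compose\<close>)
qed

lemma facet_equiv_refl:
  assumes "framed_polytope X" shows "facet_equiv X X"
proof -
  have "trunc (ambient_dim X) p = p" if "p \<in> body X" for p
    using that framed_polytopeD(3)[OF assms] by (auto intro: trunc_Rn)
  then show ?thesis unfolding facet_equiv_def
    by (intro exI[of _ "trunc (ambient_dim X)"])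
      (auto simp: int_affine_map_trunc commensurable_on_def intro!: bexI exI[of _ 1])
qed

lemma linear_part_int_affine_map:
  assumes "int_affine_map N M S" shows "linear (\<lambda>x. S x - S 0)"
proof -
  have lin: "linear (lin_part (\<lambda>x. S x i))" for i
    using assms by (auto simp: int_affine_map_def intro: linear_lin_part)
  show ?thesis
    using linear_add[OF lin] linear_scale[OF lin] by (intro linearI) (auto simp: lin_part_def fun_eq_iff)
qed

lemma affine_hull_image_linear:
  fixes f :: "'a::real_vector \<Rightarrow> 'b::real_vector"
  assumes "linear f" shows "affine hull (f ` S) = f ` (affine hull S)"
proof
  show "affine hull (f ` S) \<subseteq> f ` (affine hull S)"
  proof (rule hull_minimal)
    show "f ` S \<subseteq> f ` (affine hull S)" by (intro image_mono hull_subset)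
    show "affine (f ` (affine hull S))"
      unfolding affine_def[of "f ` (affine hull S)"]
    proof (intro ballI allI impI)
      fix x' y' and u v :: real assume "x' \<in> f ` (affine hull S)" "y' \<in> f ` (affine hull S)" and uv: "u + v = 1"
      then obtain x y where xy: "x \<in> affine hull S" "x' = f x" "y \<in> affine hull S" "y' = f y" by blast
      have "u *\<^sub>R x + v *\<^sub>R y \<in> affine hull S"
        using xy uv by (intro mem_affine affine_affine_hull)
      moreover have "u *\<^sub>R x' + v *\<^sub>R y' = f (u *\<^sub>R x + v *\<^sub>R y)"
        using xy by (simp add: linear_add[OF assms] linear_scale[OF assms])
      ultimately show "u *\<^sub>R x' + v *\<^sub>R y' \<in> f ` (affine hull S)" by blast
    qed
  qed
  have "affine {x. f x \<in> affine hull (f ` S)}"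
    unfolding affine_def[of "{x. f x \<in> affine hull (f ` S)}"]
    by (auto simp: linear_add[OF assms] linear_scale[OF assms] intro!: mem_affine[OF affine_affine_hull])
  then have "affine hull S \<subseteq> {x. f x \<in> affine hull (f ` S)}"
    by (intro hull_minimal) (auto intro: hull_inc)
  then show "f ` (affine hull S) \<subseteq> affine hull (f ` S)" by blast
qed

lemma affine_hull_affine_image:
  fixes f :: "'a::real_vector \<Rightarrow> 'b::real_vector"
  assumes "linear (\<lambda>x. f x - f 0)" shows "affine hull (f ` S) = f ` (affine hull S)"
proof -
  have img: "f ` A = (\<lambda>x. f 0 + x) ` (\<lambda>x. f x - f 0) ` A" for A by (simp add: image_image)
  show ?thesis
    by (subst (1 2) img) (simp only: affine_hull_translation affine_hull_image_linear[OF assms])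
qed

lemma direction_space_affine_image:
  assumes "int_affine_map N M S" "d \<in> direction_space (affine hull (S ` P))"
  obtains d' where "d' \<in> direction_space (affine hull P)"
    "\<And>g. int_affine M g \<Longrightarrow> lin_part (\<lambda>x. g (S x)) d' = lin_part g d"
proof -
  obtain x y where xy: "x \<in> affine hull P" "y \<in> affine hull P" "d = S x - S y"
    using assms(2) unfolding direction_space_def
      affine_hull_affine_image[OF linear_part_int_affine_map[OF assms(1)]] by blast
  have "lin_part (\<lambda>x. g (S x)) (x - y) = lin_part g d" if "int_affine M g" for g
    using lin_part_diff[OF int_affine_compose[OF that assms(1)]] lin_part_diff[OF that] xy(3) by simp
  moreover have "x - y \<in> direction_space (affine hull P)" using xy unfolding direction_space_def by blast
  ultimately show ?thesis using that by blast
qed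

text \<open>
  The condition on the neighbourhoods of the bodies, expressed at one point of the body.
\<close>

lemma morita_embedding_germ:
  assumes "morita_embedding X Z \<eta>" "framed_polytope X" "framed_polytope Z" and p: "p \<in> body X"
    and S: "int_affine_map (ambient_dim X) (ambient_dim Z) S" "\<And>x. x \<in> Rn (ambient_dim X) \<Longrightarrow> S x = \<eta> x"
  obtains U where "openin (Euclidean_space (ambient_dim X)) U" "p \<in> U"
    "\<And>x. x \<in> U \<Longrightarrow> (\<forall>h\<in>{h \<in> facet_functions X. h p = 0}. 0 \<le> h x) \<longleftrightarrow>
      (\<forall>g\<in>{g \<in> facet_functions Z. g (S p) = 0}. 0 \<le> g (S x))"
proof -
  define N M where "N = ambient_dim X" and "M = ambient_dim Z"
  from assms(1) obtain U2 U1 where inj: "inj_on \<eta> (Rn N)" and body: "\<eta> ` body X = body Z"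
    and nb: "nbhd_in N (frame X) (body X) U2" "nbhd_in M (frame Z) (body Z) U1"
    and U12: "\<eta> ` U2 = U1 \<inter> \<eta> ` Rn N"
    unfolding morita_embedding_def integral_affine_embedding_def N_def M_def by blast
  note DX = framed_polytopeD[OF assms(2), folded N_def]
  have pN: "p \<in> Rn N" using DX p by blast
  have Sp: "S p \<in> body Z" using body p S(2) pN unfolding N_def by auto
  obtain T2 where T2: "openin (Euclidean_space N) T2" "U2 = T2 \<inter> frame X"
    using nb(1) unfolding nbhd_in_def openin_subtopology by blast
  obtain T1 where T1: "openin (Euclidean_space M) T1" "U1 = T1 \<inter> frame Z"
    using nb(2) unfolding nbhd_in_def openin_subtopology by blast
  obtain e V where V: "openin (Euclidean_space N) V" "p \<in> V"
    "frame X \<inter> V = {x \<in> V. \<forall>h\<in>{h \<in> facet_functions X. h p = 0}. 0 \<le> h x}"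
    using facet_functions_at[OF assms(2) p, folded N_def] by (rule local_facetsE)
  obtain e' W where W: "openin (Euclidean_space M) W" "S p \<in> W"
    "frame Z \<inter> W = {x \<in> W. \<forall>h\<in>{h \<in> facet_functions Z. h (S p) = 0}. 0 \<le> h x}"
    using facet_functions_at[OF assms(3) Sp, folded M_def] by (rule local_facetsE)
  define U where "U = (V \<inter> T2) \<inter> {x \<in> Rn N. S x \<in> W \<inter> T1}"
  have "openin (Euclidean_space N) {x \<in> Rn N. S x \<in> W \<inter> T1}"
    by (rule openin_Rn_preimage[where M = M])
      (use S(1) W(1) T1(1) continuous_on_int_affine_map in \<open>auto simp: int_affine_map_def M_def\<close>)
  then have 1: "openin (Euclidean_space N) U" unfolding U_def using V T2 by (intro openin_Int)
  have 2: "p \<in> U" unfolding U_def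
    using V W p Sp pN nb T1 T2 unfolding nbhd_in_def by blast
  have 3: "(\<forall>h\<in>{h \<in> facet_functions X. h p = 0}. 0 \<le> h x) \<longleftrightarrow>
      (\<forall>g\<in>{g \<in> facet_functions Z. g (S p) = 0}. 0 \<le> g (S x))" if x: "x \<in> U" for x
  proof -
    have xN: "x \<in> Rn N" and xV: "x \<in> V" "x \<in> T2" "S x \<in> W" "S x \<in> T1" using x unfolding U_def by auto
    have "(\<forall>h\<in>{h \<in> facet_functions X. h p = 0}. 0 \<le> h x) \<longleftrightarrow> x \<in> frame X" using V(3) xV by blast
    also have "\<dots> \<longleftrightarrow> x \<in> U2" using T2 xV by blast
    also have "\<dots> \<longleftrightarrow> \<eta> x \<in> U1"
    proof
      assume "x \<in> U2" then show "\<eta> x \<in> U1" using U12 by blast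
    next
      assume "\<eta> x \<in> U1"
      then obtain y where "y \<in> U2" "\<eta> x = \<eta> y" using U12 xN by blast
      moreover have "y \<in> Rn N" using \<open>y \<in> U2\<close> T2(2) DX(4) by blast
      ultimately show "x \<in> U2" using inj xN by (auto simp: inj_on_def)
    qed
    also have "\<dots> \<longleftrightarrow> S x \<in> frame Z" using T1 xV S(2) xN unfolding N_def by auto
    also have "\<dots> \<longleftrightarrow> (\<forall>g\<in>{g \<in> facet_functions Z. g (S p) = 0}. 0 \<le> g (S x))" using W(3) xV by blast
    finally show ?thesis .
  qed
  show ?thesis by (rule that[OF 1[unfolded N_def] 2 3])
qed

text \<open>
  By transversality, the dual vectors of the facet functions of \<open>Z\<close> can be chosen in the
  direction space of the body of \<open>Z\<close>, which is the image of that of \<open>X\<close>. So the pullbacks have dual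
  vectors too, and both families are simplicial and define the same germ.
\<close>

lemma morita_embedding_facets:
  assumes emb: "morita_embedding X Z \<eta>" and X: "framed_polytope X" and Z: "framed_polytope Z" and p: "p \<in> body X"
    and S: "int_affine_map (ambient_dim X) (ambient_dim Z) S" "\<And>x. x \<in> Rn (ambient_dim X) \<Longrightarrow> S x = \<eta> x"
  shows "\<And>h. h \<in> facet_functions X \<Longrightarrow> h p = 0 \<Longrightarrow>
      \<exists>g\<in>facet_functions Z. commensurable_on (body X) h (\<lambda>p. g (S p))"
    and "\<And>g. g \<in> facet_functions Z \<Longrightarrow> g (S p) = 0 \<Longrightarrow>
      \<exists>h\<in>facet_functions X. commensurable_on (body X) h (\<lambda>p. g (S p))"
proof -
  define N M where "N = ambient_dim X" and "M = ambient_dim Z"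
  define I J where "I = {h \<in> facet_functions X. h p = 0}" and "J = {g \<in> facet_functions Z. g (S p) = 0}"
  note DX = framed_polytopeD[OF X, folded N_def]
  have "S ` body X = \<eta> ` body X" using DX(3) S(2) unfolding N_def by (intro image_cong) blast+
  then have body: "S ` body X = body Z" using emb unfolding morita_embedding_def by simp
  have Sp: "S p \<in> body Z" using body p by blast
  have fin: "finite I" "finite J" unfolding I_def J_def using finite_facet_functions X Z by auto
  have affI: "int_affine N h" if "h \<in> I" for h using that facet_functionsD(1)[OF X] by (simp add: I_def N_def)
  have affJ: "int_affine M h" if "h \<in> J" for h using that facet_functionsD(1)[OF Z] by (simp add: J_def M_def)
  have affS: "int_affine N (\<lambda>x. g (S x))" if "g \<in> J" for g
    using int_affine_compose[OF affJ[OF that]] S(1) by (simp add: N_def M_def)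
  obtain e V where e: "\<forall>h\<in>I. e h \<in> Zn N" "\<forall>h\<in>I. \<forall>g\<in>I. lin_part g (e h) = (if g = h then 1 else 0)"
    using facet_functions_at[OF X p, folded N_def I_def] by (rule local_facetsE)
  obtain d where "\<forall>h\<in>J. d h \<in> direction_space (affine hull body Z) \<and>
      (\<forall>g\<in>J. lin_part g (d h) = (if g = h then 1 else 0))"
    using facet_functions_transversal[OF Z Sp] unfolding J_def by (elim exE)
  then have d: "\<And>h. h \<in> J \<Longrightarrow> d h \<in> direction_space (affine hull body Z)"
    "\<And>g h. h \<in> J \<Longrightarrow> g \<in> J \<Longrightarrow> lin_part g (d h) = (if g = h then 1 else 0)"
    by simp_all
  have "\<exists>v. v \<in> direction_space (affine hull body X) \<and> (\<forall>k\<in>J. lin_part (\<lambda>x. k (S x)) v = (if k = g then 1 else 0))"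
    if g: "g \<in> J" for g
  proof -
    obtain v where "v \<in> direction_space (affine hull body X)"
      "\<And>k. int_affine M k \<Longrightarrow> lin_part (\<lambda>x. k (S x)) v = lin_part k (d g)"
      using direction_space_affine_image[OF S(1)] d(1)[OF g] unfolding body[symmetric] M_def by blast
    then show ?thesis using d(2)[OF g] affJ by auto
  qed
  then obtain v where v: "\<And>g. g \<in> J \<Longrightarrow> v g \<in> direction_space (affine hull body X)"
    "\<And>g k. g \<in> J \<Longrightarrow> k \<in> J \<Longrightarrow> lin_part (\<lambda>x. k (S x)) (v g) = (if k = g then 1 else 0)" by metis
  have vN: "v g \<in> Rn N" if "g \<in> J" for g
    using v(1)[OF that] direction_space_subset_Rn[OF DX(7)] by blast
  obtain U where U: "openin (Euclidean_space N) U" "p \<in> U"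
    "\<And>x. x \<in> U \<Longrightarrow> (\<forall>h\<in>I. 0 \<le> h x) \<longleftrightarrow> (\<forall>g\<in>J. 0 \<le> g (S x))"
    using morita_embedding_germ[OF emb X Z p S] unfolding N_def I_def J_def by blast
  \<comment> \<open>The factor is the value of an integral functional at the integral dual vector of \<open>h\<close>.\<close>
  have int: "\<exists>m::nat. m > 0 \<and> c = real m" if "h \<in> I" "g \<in> J" "c > 0" "\<forall>x\<in>Rn N. g (S x) = c * h x" for g h c
  proof -
    have eh: "e h \<in> Rn N" "\<forall>i. e h i \<in> \<int>" using e(1) that(1) by auto
    have "lin_part (\<lambda>x. g (S x)) (e h) = c * lin_part h (e h)"
      using bspec[OF that(4) eh(1)] bspec[OF that(4), of 0]
      by (simp add: lin_part_def Rn_iff algebra_simps)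
    also have "lin_part h (e h) = 1" using e(2) that(1) by auto
    finally have "c \<in> \<int>" using lin_part_Ints[OF affS[OF that(2)] eh(2)] by simp
    then obtain k where "c = of_int k" by (elim Ints_cases)
    then show ?thesis using that(3) by (intro exI[of _ "nat k"]) auto
  qed
  have comm: "commensurable_on (body X) h (\<lambda>p. g (S p))"
    if gh: "h \<in> I" "g \<in> J" "c > 0" "\<forall>x\<in>Rn N. g (S x) = c * h x" for g h c
  proof -
    obtain m :: nat where m: "m > 0" "c = real m" using int[OF gh] by blast
    show ?thesis
    proof (rule commensurable_onI[OF m(1), of 1])
      fix q assume "q \<in> body X"
      then have "g (S q) = c * h q" using gh(4) DX(3) by blast
      then show "real m * h q = real 1 * g (S q)" using m(2) by simp
    qed simp
  qed
  have eI: "e h \<in> Rn N" "\<And>k. k \<in> I \<Longrightarrow> lin_part (id k) (e h) = (if k = h then 1 else 0)" if "h \<in> I" for h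
    using e that by auto
  have idI: "int_affine N (id h)" "id h p = 0" if "h \<in> I" for h using affI that by (auto simp: I_def)
  have zJ: "g (S p) = 0" if "g \<in> J" for g using that by (simp add: J_def)
  have germ: "(\<forall>h\<in>I. 0 \<le> id h x) \<longleftrightarrow> (\<forall>g\<in>J. 0 \<le> g (S x))" if "x \<in> U" for x using U(3)[OF that] by simp
  show "\<exists>g\<in>facet_functions Z. commensurable_on (body X) h (\<lambda>p. g (S p))"
    if "h \<in> facet_functions X" "h p = 0" for h
  proof -
    have h: "h \<in> I" using that by (simp add: I_def)
    have "\<exists>g\<in>J. \<exists>c>0. \<forall>x\<in>Rn N. id h x = c * g (S x)"
      by (rule facets_proportional[where I = I and J = J and N = N and F = id and G = "\<lambda>g x. g (S x)"
            and u = e and v = v and p = p and U = U])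
        (fact fin(1), fact fin(2), fact idI(1), fact affS, fact idI(2), fact zJ, fact eI(1), fact eI(2),
         fact vN, fact v(2), fact U(1), fact U(2), fact germ, fact h)
    then obtain g c where gc: "g \<in> J" "c > 0" "\<forall>x\<in>Rn N. h x = c * g (S x)" by auto
    then have "commensurable_on (body X) h (\<lambda>p. g (S p))" by (intro comm[OF h gc(1), of "1 / c"]) auto
    then show ?thesis using gc(1) by (auto simp: J_def)
  qed
  show "\<exists>h\<in>facet_functions X. commensurable_on (body X) h (\<lambda>p. g (S p))"
    if "g \<in> facet_functions Z" "g (S p) = 0" for g
  proof -
    have g: "g \<in> J" using that by (simp add: J_def)
    have "\<exists>h\<in>I. \<exists>c>0. \<forall>x\<in>Rn N. g (S x) = c * id h x"
      by (rule facets_proportional[where I = J and J = I and N = N and F = "\<lambda>g x. g (S x)" and G = id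
            and u = v and v = e and p = p and U = U])
        (fact fin(2), fact fin(1), fact affS, fact idI(1), fact zJ, fact idI(2), fact vN, fact v(2),
         fact eI(1), fact eI(2), fact U(1), fact U(2), fact germ[symmetric], fact g)
    then obtain h c where hc: "h \<in> I" "c > 0" "\<forall>x\<in>Rn N. g (S x) = c * h x" by auto
    then have "commensurable_on (body X) h (\<lambda>p. g (S p))" by (intro comm[OF hc(1) g]) auto
    then show ?thesis using hc(1) by (auto simp: I_def)
  qed
qed

lemma morita_embedding_facet_equiv:
  assumes emb: "morita_embedding X Z \<eta>" and X: "framed_polytope X" and Z: "framed_polytope Z"
  shows "facet_equiv X Z"
proof -
  have "integral_affine_embedding (ambient_dim X) (ambient_dim Z) \<eta>"
    using emb unfolding morita_embedding_def by blast
  then obtain S T where ST: "int_affine_map (ambient_dim X) (ambient_dim Z) S"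
    "int_affine_map (ambient_dim Z) (ambient_dim X) T"
    and S: "\<And>x. x \<in> Rn (ambient_dim X) \<Longrightarrow> S x = \<eta> x" and T: "\<And>x. x \<in> Rn (ambient_dim X) \<Longrightarrow> T (S x) = x"
    using integral_affine_embedding_retract by blast
  note DX = framed_polytopeD[OF X]
  have "S ` body X = \<eta> ` body X" using DX(3) S by (intro image_cong) blast+
  then have body: "S ` body X = body Z" using emb unfolding morita_embedding_def by simp
  have "\<exists>g\<in>facet_functions Z. commensurable_on (body X) h (\<lambda>p. g (S p))" if "h \<in> facet_functions X" for h
    using facet_functionsD(3)[OF X that] morita_embedding_facets(1)[OF emb X Z _ ST(1) S that] by blast
  moreover have "\<exists>h\<in>facet_functions X. commensurable_on (body X) h (\<lambda>p. g (S p))" if g: "g \<in> facet_functions Z" for g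
  proof -
    obtain p where p: "p \<in> body X" "g (S p) = 0"
      using facet_functionsD(3)[OF Z g] unfolding body[symmetric] by (elim bexE imageE) simp
    show ?thesis by (rule morita_embedding_facets(2)[OF emb X Z p(1) ST(1) S g p(2)])
  qed
  moreover have "\<forall>p\<in>body X. T (S p) = p" using T DX(3) by blast
  ultimately show ?thesis unfolding facet_equiv_def using ST body by blast
qed


section \<open>Images of simple polytopes under injective affine maps\<close>

lemma affine_dependent_affine_image:
  fixes f :: "'a::real_vector \<Rightarrow> 'b::real_vector"
  assumes "linear (\<lambda>x. f x - f 0)" "inj f"
  shows "affine_dependent (f ` B) \<longleftrightarrow> affine_dependent B"
proof -
  have "f b \<in> affine hull (f ` B - {f b}) \<longleftrightarrow> b \<in> affine hull (B - {b})" for b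
  proof -
    have "f ` B - {f b} = f ` (B - {b})" using image_set_diff[OF assms(2), of B "{b}"] by simp
    then show ?thesis
      by (simp add: affine_hull_affine_image[OF assms(1)] inj_image_mem_iff[OF assms(2)])
  qed
  then show ?thesis unfolding affine_dependent_def by simp
qed

lemma has_aff_dim_affine_image:
  assumes "linear (\<lambda>x. f x - f 0)" "inj f"
  shows "has_aff_dim (f ` S) d \<longleftrightarrow> has_aff_dim S d"
proof
  assume "has_aff_dim (f ` S) d"
  then obtain B where B: "affine hull B = affine hull (f ` S)" "\<not> affine_dependent B" "card B = d + 1"
    unfolding has_aff_dim_def by blast
  have "B \<subseteq> f ` (affine hull S)"
    using hull_subset[of B affine] unfolding B(1) affine_hull_affine_image[OF assms(1)] .
  then obtain C where C: "B = f ` C" by (elim subset_imageE)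
  have "f ` (affine hull C) = f ` (affine hull S)"
    using B(1) unfolding C affine_hull_affine_image[OF assms(1)] .
  then have "affine hull C = affine hull S" by (simp add: inj_image_eq_iff[OF assms(2)])
  moreover have "card C = d + 1"
    using B(3) unfolding C by (simp add: card_image inj_on_subset[OF assms(2)])
  ultimately show "has_aff_dim S d" unfolding has_aff_dim_def
    using B(2) unfolding C affine_dependent_affine_image[OF assms] by blast
next
  assume "has_aff_dim S d"
  then obtain B where B: "affine hull B = affine hull S" "\<not> affine_dependent B" "card B = d + 1"
    unfolding has_aff_dim_def by blast
  show "has_aff_dim (f ` S) d" unfolding has_aff_dim_def
  proof (intro exI conjI)
    show "affine hull (f ` B) = affine hull (f ` S)" by (simp add: affine_hull_affine_image[OF assms(1)] B(1))
    show "\<not> affine_dependent (f ` B)" using B(2) affine_dependent_affine_image[OF assms] by blast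
    show "card (f ` B) = d + 1" using B(3) by (simp add: card_image inj_on_subset[OF assms(2)])
  qed
qed

lemma face_of_affine_image:
  fixes f :: "'a::real_vector \<Rightarrow> 'b::real_vector"
  assumes "linear (\<lambda>x. f x - f 0)" "inj f"
  shows "f ` C face_of f ` S \<longleftrightarrow> C face_of S"
proof -
  have img: "f ` A = (+) (f 0) ` (\<lambda>x. f x - f 0) ` A" for A by (simp add: image_image)
  have "inj (\<lambda>x. f x - f 0)" using assms(2) by (auto simp: inj_on_def)
  then show ?thesis unfolding img[of C] img[of S]
    by (simp add: face_of_linear_image[OF assms(1)])
qed

lemma simple_polytope_affine_image:
  assumes f: "linear (\<lambda>x. f x - f 0)" "inj f" and P: "simple_polytope n P"
  shows "simple_polytope n (f ` P)"
proof -
  have "f ` P = (+) (f 0) ` (\<lambda>x. f x - f 0) ` P" by (simp add: image_image)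
  then have "polytope (f ` P)"
    using P polytope_linear_image[OF f(1)] polytope_translation_eq unfolding simple_polytope_def by metis
  moreover have "has_aff_dim (f ` P) n"
    using P has_aff_dim_affine_image[OF f] unfolding simple_polytope_def by blast
  moreover have "card {G. G face_of f ` P \<and> has_aff_dim G (s + 1) \<and> F \<subseteq> G} = n - s"
    if F: "s \<le> n" "F face_of f ` P" "has_aff_dim F s" for s F
  proof -
    obtain E where E: "F = f ` E" using face_of_imp_subset[OF F(2)] by (elim subset_imageE)
    have "E face_of P" "has_aff_dim E s"
      using F unfolding E face_of_affine_image[OF f] has_aff_dim_affine_image[OF f] by blast+
    then have card: "card {G. G face_of P \<and> has_aff_dim G (s + 1) \<and> E \<subseteq> G} = n - s"
      using P F(1) unfolding simple_polytope_def by blast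
    have "{G. G face_of f ` P \<and> has_aff_dim G (s + 1) \<and> F \<subseteq> G} =
        (`) f ` {G. G face_of P \<and> has_aff_dim G (s + 1) \<and> E \<subseteq> G}" (is "?A = ?B")
    proof
      show "?A \<subseteq> ?B"
      proof
        fix G assume G: "G \<in> ?A"
        then have "G \<subseteq> f ` P" using face_of_imp_subset by blast
        then obtain H where H: "G = f ` H" by (elim subset_imageE)
        then have "H face_of P \<and> has_aff_dim H (s + 1) \<and> E \<subseteq> H"
          using G unfolding H E
          by (simp add: face_of_affine_image[OF f] has_aff_dim_affine_image[OF f] inj_image_subset_iff[OF f(2)])
        then show "G \<in> ?B" using H by blast
      qed
      show "?B \<subseteq> ?A" unfolding E
        by (auto simp: face_of_affine_image[OF f] has_aff_dim_affine_image[OF f])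
    qed
    moreover have "inj_on ((`) f) A" for A by (rule inj_onI) (simp add: inj_image_eq_iff[OF f(2)])
    ultimately show ?thesis using card by (simp add: card_image)
  qed
  ultimately show ?thesis unfolding simple_polytope_def by blast
qed

text \<open>
  The map \<open>\<theta>\<close> ignores the coordinates from \<open>N\<close> on. Appending them from position \<open>D\<close> on makes it
  injective on all sequences, without changing it on \<open>\<real>\<^sup>N\<close>.
\<close>

lemma simple_polytope_int_affine_image:
  assumes \<theta>: "int_affine_map N D \<theta>" and inj: "inj_on \<theta> (Rn N)" and P: "simple_polytope n P" "P \<subseteq> Rn N"
  shows "simple_polytope n (\<theta> ` P)"
proof -
  define G :: "point \<Rightarrow> point" where "G x = (\<lambda>i. if i < D then \<theta> x i else x (i - D + N))" for x
  have "linear (\<lambda>x. G x - G 0)"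
  proof -
    note lin = linear_part_int_affine_map[OF \<theta>]
    have "G (x + y) - G 0 = (G x - G 0) + (G y - G 0)" for x y
      using fun_cong[OF linear_add[OF lin, of x y]] by (auto simp: G_def fun_eq_iff)
    moreover have "G (r *\<^sub>R x) - G 0 = r *\<^sub>R (G x - G 0)" for r x
      using fun_cong[OF linear_scale[OF lin, of r x]] by (auto simp: G_def fun_eq_iff)
    ultimately show ?thesis by (intro linearI)
  qed
  moreover have "inj G"
  proof (rule injI)
    fix x y assume eq: "G x = G y"
    have "\<theta> (trunc N x) i = \<theta> (trunc N y) i" for i
    proof (cases "i < D")
      case True
      have "\<theta> x i = \<theta> y i" using fun_cong[OF eq, of i] True by (simp add: G_def)
      then show ?thesis using \<theta> int_affine_trunc[of N "\<lambda>x. \<theta> x i"] by (simp add: int_affine_map_def)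
    qed (use \<theta> in \<open>simp add: int_affine_map_def Rn_iff\<close>)
    then have "\<theta> (trunc N x) = \<theta> (trunc N y)" by (rule ext)
    then have tr: "trunc N x = trunc N y" using inj by (simp add: inj_on_eq_iff)
    show "x = y"
    proof
      fix i show "x i = y i"
      proof (cases "i < N")
        case True
        then show ?thesis using fun_cong[OF tr, of i] by (simp add: trunc_def)
      next
        case False
        then obtain j where j: "i = N + j" using le_Suc_ex[of N i] by auto
        show ?thesis using fun_cong[OF eq, of "D + j"] by (simp add: G_def j add.commute)
      qed
    qed
  qed
  moreover have "\<theta> ` P = G ` P"
  proof (rule image_cong[OF refl])
    fix x assume "x \<in> P"
    then have "x \<in> Rn N" using P(2) by blast
    then show "\<theta> x = G x" using \<theta> by (auto simp: G_def fun_eq_iff int_affine_map_def Rn_iff)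
  qed
  ultimately show ?thesis using simple_polytope_affine_image P(1) by metis
qed


section \<open>Criteria for framings and embeddings\<close>

lemma has_aff_dim_Rn:
  assumes "affine hull S = Rn N" shows "has_aff_dim S N"
proof -
  define B where "B = std_vec ` {..<N}"
  have inj: "inj_on std_vec {..<N}"
    by (rule inj_onI) (metis std_vec_def zero_neq_one)
  have B0: "0 \<notin> B" unfolding B_def
  proof
    assume "0 \<in> std_vec ` {..<N}"
    then obtain j where "0 = std_vec j" by blast
    then have "(0::point) j = std_vec j j" by simp
    then show False by (simp add: std_vec_def)
  qed
  have ind: "independent B"
  proof (rule independent_if_scalars_zero)
    show "finite B" by (simp add: B_def)
    fix f x assume sum: "(\<Sum>x\<in>B. f x *\<^sub>R x) = 0" and x: "x \<in> B"
    obtain j where j: "j < N" "x = std_vec j" using x by (auto simp: B_def)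
    have "(\<Sum>x\<in>B. f x *\<^sub>R x) = (\<Sum>i<N. f (std_vec i) *\<^sub>R std_vec i)"
      unfolding B_def using inj by (simp add: sum.reindex)
    then have "(\<Sum>i<N. f (std_vec i) *\<^sub>R std_vec i) j = 0" using sum by simp
    moreover have "(\<Sum>i<N. f (std_vec i) *\<^sub>R std_vec i) j = (\<Sum>i<N. if i = j then f (std_vec i) else 0)"
      unfolding point_sum_apply by (intro sum.cong) (auto simp: std_vec_def)
    ultimately show "f x = 0" using j by simp
  qed
  have "affine hull (insert 0 B) = span (insert 0 B)" by (rule affine_hull_span_0) (simp add: hull_inc)
  also have "\<dots> = span B" by (simp add: span_insert_0)
  also have "\<dots> = Rn N"
  proof
    show "span B \<subseteq> Rn N" by (rule span_minimal) (auto simp: B_def std_vec_def Rn_iff intro: subspace_Rn)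
    show "Rn N \<subseteq> span B"
    proof
      fix x assume "x \<in> Rn N"
      then have "x = (\<Sum>j<N. x j *\<^sub>R std_vec j)" by (rule std_vec_expansion)
      also have "\<dots> \<in> span B" by (intro span_sum span_scale span_base) (simp add: B_def)
      finally show "x \<in> span B" .
    qed
  qed
  finally have "affine hull (insert 0 B) = affine hull S" using assms by simp
  moreover have "\<not> affine_dependent (insert 0 B)" using ind by (simp add: affine_dependent_iff_dependent[OF B0])
  moreover have "card (insert 0 B) = N + 1"
    using B0 inj by (simp add: B_def card_image)
  ultimately show ?thesis unfolding has_aff_dim_def by blast
qed

text \<open>
  Every point other than \<open>q\<close> lies on a line through \<open>q\<close> and a second point of \<open>U\<close>.
\<close>

lemma has_aff_dim_nonempty_interior:
  assumes "openin (Euclidean_space N) U" "q \<in> U" "U \<subseteq> Q" "Q \<subseteq> Rn N"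
  shows "has_aff_dim Q N"
proof (rule has_aff_dim_Rn, rule antisym)
  show "affine hull Q \<subseteq> Rn N" using assms(4) by (intro hull_minimal subspace_imp_affine subspace_Rn)
  have q: "q \<in> Rn N" "q \<in> Q" using assms by auto
  show "Rn N \<subseteq> affine hull Q"
  proof
    fix x assume x: "x \<in> Rn N"
    obtain t where t: "t > 0" "q + t *\<^sub>R (x - q) \<in> U"
      using openin_ray[OF assms(1,2) subspace_diff[OF subspace_Rn x q(1)]] by blast
    have "(1 - 1 / t) *\<^sub>R q + (1 / t) *\<^sub>R (q + t *\<^sub>R (x - q)) \<in> affine hull Q"
      by (rule mem_affine[OF affine_affine_hull]) (use q t assms(3) in \<open>auto intro: hull_inc\<close>)
    also have "(1 - 1 / t) *\<^sub>R q + (1 / t) *\<^sub>R (q + t *\<^sub>R (x - q)) = x"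
      using t(1) by (simp add: algebra_simps)
    finally show "x \<in> affine hull Q" .
  qed
qed

lemma subspace_direction_space:
  assumes "affine L" "L \<noteq> {}" shows "subspace (direction_space L)"
proof -
  obtain a where a: "a \<in> L" using assms(2) by blast
  have "direction_space L = (\<lambda>x. - a + x) ` L"
  proof
    show "direction_space L \<subseteq> (\<lambda>x. - a + x) ` L"
    proof
      fix d assume "d \<in> direction_space L"
      then obtain x y where xy: "x \<in> L" "y \<in> L" "d = x - y" unfolding direction_space_def by blast
      then have "x - y + a \<in> L" using mem_affine_3_minus[OF assms(1) a xy(1,2), of 1] by (simp add: add.commute)
      then show "d \<in> (\<lambda>x. - a + x) ` L" using xy by (intro image_eqI[of _ _ "x - y + a"]) auto
    qed
    show "(\<lambda>x. - a + x) ` L \<subseteq> direction_space L"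
    proof (rule image_subsetI)
      fix x assume "x \<in> L"
      moreover have "- a + x = x - a" by simp
      ultimately show "- a + x \<in> direction_space L" using a unfolding direction_space_def by blast
    qed
  qed
  then show ?thesis using affine_diffs_subspace[OF assms(1) a] by simp
qed

text \<open>
  Transversality quantifies over all charts, but the functions of any chart form the unique set of
  local facets. With dual vectors in the direction space of \<open>L\<close>, the components of a vector with
  respect to these functions can be removed by a vector along \<open>L\<close>.
\<close>

lemma transversalI:
  assumes L: "affine L" "L \<subseteq> Rn N"
    and ex: "\<And>x. x \<in> L \<inter> Q \<Longrightarrow> \<exists>H d. local_facets N Q x H \<and>
      (\<forall>h\<in>H. d h \<in> direction_space L \<and> (\<forall>g\<in>H. lin_part g (d h) = (if g = h then 1 else 0)))"
  shows "transversal N L Q"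
  unfolding transversal_def
proof (intro ballI allI impI)
  fix x0 s A b J
  assume x0: "x0 \<in> L \<inter> Q" and ch: "corner_chart N Q x0 s A b" and J: "J \<subseteq> {..<s}"
  have A: "A \<in> GL_int N" "s \<le> N" using ch by (auto simp: corner_chart_def)
  obtain H d where H: "local_facets N Q x0 H" and d: "\<forall>h\<in>H. d h \<in> direction_space L \<and>
      (\<forall>g\<in>H. lin_part g (d h) = (if g = h then 1 else 0))" using ex[OF x0] by blast
  have "H = aff_coord A b ` {..<s}" using local_facets_unique[OF H corner_chart_local_facets[OF ch]] .
  note d' = d[unfolded this]
  define u where "u i = d (aff_coord A b i)" for i
  have u: "u i \<in> direction_space L" if "i < s" for i using d' that unfolding u_def by blast
  have uj: "lin_coord A j (u i) = (if j = i then 1 else 0)" if "i < s" "j < s" for i j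
  proof -
    have "lin_part (aff_coord A b j) (u i) = (if aff_coord A b j = aff_coord A b i then 1 else 0)"
      using d' that unfolding u_def by blast
    then show ?thesis using inj_on_aff_coord[OF A, of b] that by (simp add: lin_part_aff_coord inj_on_eq_iff)
  qed
  have L0: "L \<noteq> {}" using x0 by blast
  note sub = subspace_direction_space[OF L(1) L0]
  have dR: "direction_space L \<subseteq> Rn N" by (rule direction_space_subset_Rn[OF L(2)])
  show "{u + v |u v. u \<in> direction_space L \<and> v \<in> Rn N \<and> (\<forall>j\<in>J. lin_coord A j v = 0)} = Rn N" (is "?A = _")
  proof
    show "?A \<subseteq> Rn N" using dR subspace_add[OF subspace_Rn] by blast
    show "Rn N \<subseteq> ?A"
    proof
      fix x assume x: "x \<in> Rn N"
      define w where "w = (\<Sum>i<s. lin_coord A i x *\<^sub>R u i)"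
      have w: "w \<in> direction_space L" unfolding w_def
        by (intro subspace_sum[OF sub] subspace_scale[OF sub] u) simp
      have lin: "linear (lin_coord A j)" for j
        by (rule linearI) (simp_all add: lin_coord_def algebra_simps sum.distrib sum_distrib_left)
      have "lin_coord A j (x - w) = 0" if "j \<in> J" for j
      proof -
        have j: "j < s" using J that by blast
        have "lin_coord A j w = (\<Sum>i<s. lin_coord A i x * lin_coord A j (u i))"
          unfolding w_def by (simp add: linear_sum[OF lin] linear_scale[OF lin])
        also have "\<dots> = (\<Sum>i<s. if i = j then lin_coord A i x else 0)"
          using j by (intro sum.cong) (auto simp: uj)
        finally show ?thesis using j by (simp add: linear_diff[OF lin])
      qed
      moreover have "x - w \<in> Rn N" using x w dR subspace_diff[OF subspace_Rn] by blast
      ultimately show "x \<in> ?A" using w by (intro CollectI exI[of _ w] exI[of _ "x - w"]) simp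
    qed
  qed
qed

text \<open>
  If \<open>k u = f z\<close> then \<open>u = f (r u)\<close>, where \<open>f\<close> and \<open>r\<close> are the linear parts.
\<close>

lemma integral_affine_embeddingI:
  assumes \<theta>: "int_affine_map N M \<theta>" and \<rho>: "int_affine_map M N \<rho>"
    and inv: "\<And>x. x \<in> Rn N \<Longrightarrow> \<rho> (\<theta> x) = x" and "N \<le> M"
  shows "integral_affine_embedding N M \<theta>"
proof -
  define f r where "f x = \<theta> x - \<theta> 0" and "r u = \<rho> u - \<rho> 0" for x u
  have f: "linear f" unfolding f_def by (rule linear_part_int_affine_map[OF \<theta>])
  have r: "linear r" unfolding r_def by (rule linear_part_int_affine_map[OF \<rho>])
  have \<theta>R: "\<theta> x \<in> Rn M" for x using \<theta> by (simp add: int_affine_map_def)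
  have \<rho>R: "\<rho> x \<in> Rn N" for x using \<rho> by (simp add: int_affine_map_def)
  have fZ: "f z \<in> Zn M" if "z \<in> Zn N" for z
  proof -
    have "f z i \<in> \<int>" for i
      using lin_part_Ints[of N "\<lambda>x. \<theta> x i" z] \<theta> that by (simp add: int_affine_map_def f_def lin_part_def)
    then show ?thesis using \<theta>R subspace_diff[OF subspace_Rn] by (simp add: f_def)
  qed
  have rZ: "r z \<in> Zn N" if "z \<in> Zn M" for z
  proof -
    have "r z i \<in> \<int>" for i
      using lin_part_Ints[of M "\<lambda>x. \<rho> x i" z] \<rho> that by (simp add: int_affine_map_def r_def lin_part_def)
    then show ?thesis using \<rho>R subspace_diff[OF subspace_Rn] by (simp add: r_def)
  qed
  have rf: "r (f z) = z" if "z \<in> Rn N" for z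
  proof -
    have "r (f z) = r (\<theta> z) - r (\<theta> 0)" unfolding f_def by (rule linear_diff[OF r])
    also have "\<dots> = \<rho> (\<theta> z) - \<rho> (\<theta> 0)" by (simp add: r_def)
    also have "\<dots> = z" using inv[OF that] inv[of 0] by (simp add: Rn_iff)
    finally show ?thesis .
  qed
  have \<Lambda>: "(\<lambda>z. \<theta> z + - \<theta> 0) ` carrier (int_lattice N) = f ` Zn N"
    by (simp add: f_def carrier_int_lattice)
  have sub: "subgroup (f ` Zn N) (int_lattice M)"
  proof -
    interpret comm_group "int_lattice M" by (rule comm_group_int_lattice)
    have inv: "inv\<^bsub>int_lattice M\<^esub> f z = f (- z)" if "z \<in> Zn N" for z
    proof (rule inv_equality)
      show "f (- z) \<otimes>\<^bsub>int_lattice M\<^esub> f z = \<one>\<^bsub>int_lattice M\<^esub>"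
        by (simp add: int_lattice_def linear_neg[OF f])
      have "- z \<in> Zn N" using that subspace_neg[OF subspace_Rn] by simp
      then show "f z \<in> carrier (int_lattice M)" "f (- z) \<in> carrier (int_lattice M)"
        unfolding carrier_int_lattice using fZ that by blast+
    qed
    show ?thesis
    proof (rule subgroupI)
      show "f ` Zn N \<subseteq> carrier (int_lattice M)" using fZ unfolding carrier_int_lattice by blast
      have "0 \<in> Zn N" by (simp add: Rn_iff)
      then show "f ` Zn N \<noteq> {}" by blast
    next
      fix a assume "a \<in> f ` Zn N"
      then obtain z where z: "z \<in> Zn N" "a = f z" by blast
      have "- z \<in> Zn N" using z(1) subspace_neg[OF subspace_Rn] by simp
      then show "inv\<^bsub>int_lattice M\<^esub> a \<in> f ` Zn N" using inv[OF z(1)] z(2) by simp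
    next
      fix a b assume "a \<in> f ` Zn N" "b \<in> f ` Zn N"
      then obtain z w where z: "z \<in> Zn N" "a = f z" "w \<in> Zn N" "b = f w" by blast
      then have "z + w \<in> Zn N" using subspace_add[OF subspace_Rn] by simp
      moreover have "a \<otimes>\<^bsub>int_lattice M\<^esub> b = f (z + w)"
        using z by (simp add: int_lattice_def linear_add[OF f])
      ultimately show "a \<otimes>\<^bsub>int_lattice M\<^esub> b \<in> f ` Zn N" by simp
    qed
  qed
  have "torsion_free (int_lattice M Mod (f ` Zn N))"
    unfolding torsion_free_quotient_iff[OF sub]
  proof (intro ballI allI impI, elim conjE)
    fix u and k :: nat assume u: "u \<in> Zn M" "k > 0" "real k *\<^sub>R u \<in> f ` Zn N"
    then obtain z where z: "z \<in> Zn N" "real k *\<^sub>R u = f z" by blast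
    have "real k *\<^sub>R r u = z" using arg_cong[OF z(2), of r] rf[of z] z(1) by (simp add: linear_scale[OF r])
    then have "real k *\<^sub>R f (r u) = real k *\<^sub>R u" using z(2) by (simp flip: linear_scale[OF f])
    then have fru: "f (r u) = u" using u(2) by simp
    have "f (r u) \<in> f ` Zn N" by (rule imageI[OF rZ[OF u(1)]])
    then show "u \<in> f ` Zn N" unfolding fru .
  qed
  moreover have "inj_on \<theta> (Rn N)" by (rule inj_on_inverseI[of _ \<rho>]) (rule inv)
  moreover have "affine_map N M \<theta>" unfolding affine_map_def
  proof (intro conjI exI ballI)
    show "\<theta> ` Rn N \<subseteq> Rn M" using \<theta>R by blast
    show "linear f" by (rule f)
    show "\<theta> x = f x + \<theta> 0" for x by (simp add: f_def)
  qed
  moreover have "- \<theta> 0 \<in> Rn M" by (rule subspace_neg[OF subspace_Rn \<theta>R])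
  ultimately show ?thesis unfolding integral_affine_embedding_def Let_def
    using sub assms(4) \<Lambda> by (intro conjI bexI[of _ "- \<theta> 0"]) simp_all
qed

text \<open>
  The functions \<open>f k\<close> with \<open>k \<in> Z\<close> are completed to a coordinate system by the standard coordinates
  other than the \<open>K + k\<close> with \<open>k \<in> Z\<close>. The matrix is a row permutation of \<open>\<delta> + n\<close>, where \<open>n\<close> has
  square zero, so its inverse is a column permutation of \<open>\<delta> - n\<close>.
\<close>

lemma unimodular_chart:
  fixes C :: "nat \<Rightarrow> nat \<Rightarrow> int" and c :: "nat \<Rightarrow> real" and K m :: nat
  assumes f: "\<And>k w. k < m \<Longrightarrow> f k w = (\<Sum>j<K. of_int (C k j) * w j) + w (K + k) + c k"
    and Z: "Z \<subseteq> {..<m}"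
  shows "\<exists>s A b. s \<le> K + m \<and> A \<in> GL_int (K + m) \<and> b \<in> Rn (K + m) \<and> aff_coord A b ` {..<s} = f ` Z"
proof -
  define D s where "D = K + m" and "s = card Z"
  have finZ: "finite Z" using Z finite_subset by blast
  have KZ: "(+) K ` Z \<subseteq> {..<D}" using Z by (auto simp: D_def)
  have cardKZ: "card ((+) K ` Z) = s" by (simp add: s_def card_image)
  have sD: "s \<le> D" using card_mono[OF _ KZ] cardKZ by simp
  \<comment> \<open>The permutation \<open>\<pi>\<close> moves the rows with index in \<open>K + Z\<close> to the front.\<close>
  obtain \<pi>1 where \<pi>1: "bij_betw \<pi>1 {..<s} ((+) K ` Z)"
    using finite_same_card_bij[of "{..<s}" "(+) K ` Z"] cardKZ finZ by auto
  obtain \<pi>2 where \<pi>2: "bij_betw \<pi>2 {s..<D} ({..<D} - (+) K ` Z)"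
    using finite_same_card_bij[of "{s..<D}" "{..<D} - (+) K ` Z"] card_Diff_subset[OF _ KZ] cardKZ finZ by auto
  define \<pi> where "\<pi> i = (if i < s then \<pi>1 i else \<pi>2 i)" for i
  have \<pi>s: "\<pi> ` {..<s} = (+) K ` Z" using \<pi>1 by (simp add: \<pi>_def bij_betw_def)
  have "bij_betw \<pi> ({..<s} \<union> {s..<D}) ((+) K ` Z \<union> ({..<D} - (+) K ` Z))"
  proof (rule bij_betw_combine)
    show "bij_betw \<pi> {..<s} ((+) K ` Z)" using \<pi>1 bij_betw_cong[of "{..<s}" \<pi> \<pi>1] by (simp add: \<pi>_def)
    show "bij_betw \<pi> {s..<D} ({..<D} - (+) K ` Z)" using \<pi>2 bij_betw_cong[of "{s..<D}" \<pi> \<pi>2] by (simp add: \<pi>_def)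
  qed auto
  moreover have "{..<s} \<union> {s..<D} = {..<D}" using sD by auto
  moreover have "(+) K ` Z \<union> ({..<D} - (+) K ` Z) = {..<D}" using KZ by blast
  ultimately have \<pi>: "bij_betw \<pi> {..<D} {..<D}" by simp
  then have \<pi>D: "\<pi> i < D" if "i < D" for i using that by (auto simp: bij_betw_def)
  define n :: "nat \<Rightarrow> nat \<Rightarrow> int" where "n i j = (if K \<le> i \<and> i < D \<and> j < K then C (i - K) j else 0)" for i j
  define \<delta> :: "nat \<Rightarrow> nat \<Rightarrow> int" where "\<delta> i j = (if i = j then 1 else 0)" for i j
  have prod: "(\<Sum>k<D. (\<delta> i k + \<epsilon> * n i k) * (\<delta> k j - \<epsilon> * n k j)) = \<delta> i j" if "i < D" "j < D" for i j \<epsilon>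
  proof -
    have nn: "n i k * n k j = 0" for k by (simp add: n_def)
    have "(\<Sum>k<D. (\<delta> i k + \<epsilon> * n i k) * (\<delta> k j - \<epsilon> * n k j))
        = (\<Sum>k<D. (if k = i then \<delta> k j else 0) + (if k = j then \<epsilon> * n i k else 0) - (if k = i then \<epsilon> * n k j else 0))"
      using nn by (intro sum.cong) (auto simp: \<delta>_def algebra_simps)
    also have "\<dots> = \<delta> i j" using that by (simp add: sum.distrib sum_subtractf)
    finally show ?thesis .
  qed
  define A where "A = mat D D (\<lambda>(i, j). \<delta> (\<pi> i) j + n (\<pi> i) j)"
  define B where "B = mat D D (\<lambda>(i, j). \<delta> i (\<pi> j) - n i (\<pi> j))"
  have AB: "A * B = 1\<^sub>m D"
  proof (rule eq_matI)
    fix i j assume ij: "i < dim_row (1\<^sub>m D)" "j < dim_col (1\<^sub>m D)"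
    then have "(A * B) $$ (i, j) = (\<Sum>k<D. (\<delta> (\<pi> i) k + 1 * n (\<pi> i) k) * (\<delta> k (\<pi> j) - 1 * n k (\<pi> j)))"
      by (simp add: A_def B_def scalar_prod_def atLeast0LessThan)
    also have "\<dots> = \<delta> (\<pi> i) (\<pi> j)" using ij \<pi>D by (intro prod) auto
    also have "\<dots> = 1\<^sub>m D $$ (i, j)"
      using ij \<pi> by (auto simp: \<delta>_def bij_betw_def inj_on_eq_iff)
    finally show "(A * B) $$ (i, j) = 1\<^sub>m D $$ (i, j)" .
  qed (simp_all add: A_def B_def)
  have BA: "B * A = 1\<^sub>m D"
  proof (rule eq_matI)
    fix i j assume ij: "i < dim_row (1\<^sub>m D)" "j < dim_col (1\<^sub>m D)"
    then have "(B * A) $$ (i, j) = (\<Sum>k<D. (\<delta> i (\<pi> k) + (-1) * n i (\<pi> k)) * (\<delta> (\<pi> k) j - (-1) * n (\<pi> k) j))"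
      by (simp add: A_def B_def scalar_prod_def atLeast0LessThan)
    also have "\<dots> = (\<Sum>k<D. (\<delta> i k + (-1) * n i k) * (\<delta> k j - (-1) * n k j))"
      by (rule sum.reindex_bij_betw[OF \<pi>])
    also have "\<dots> = \<delta> i j" using ij by (intro prod) auto
    also have "\<dots> = 1\<^sub>m D $$ (i, j)" using ij by (simp add: \<delta>_def)
    finally show "(B * A) $$ (i, j) = 1\<^sub>m D $$ (i, j)" .
  qed (simp_all add: A_def B_def)
  have A: "A \<in> carrier_mat D D" by (simp add: A_def)
  have AGL: "A \<in> GL_int D" unfolding GL_int_def invertible_mat_def inverts_mat_def square_mat.simps
    using A AB BA by (auto intro!: exI[of _ B] simp: B_def)
  define b where "b i = (if i < s then c (\<pi> i - K) else 0)" for i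
  have bD: "b \<in> Rn D" using sD by (simp add: Rn_iff b_def)
  have "aff_coord A b i = f (\<pi> i - K)" if i: "i < s" for i
  proof
    fix w
    have "\<pi> i \<in> (+) K ` Z" using \<pi>s i by blast
    then obtain k where k: "k \<in> Z" "\<pi> i = K + k" by blast
    have km: "k < m" using k Z by blast
    have iD: "i < D" using i sD by simp
    have "lin_coord A i w = (\<Sum>j<D. (if j = K + k then w j else 0) + (if j < K then of_int (C k j) * w j else 0))"
      unfolding lin_coord_def using A iD km
      by (intro sum.cong) (auto simp: A_def k(2) \<delta>_def n_def D_def)
    also have "\<dots> = w (K + k) + (\<Sum>j<D. if j < K then of_int (C k j) * w j else 0)"
      using km by (simp add: sum.distrib D_def)
    also have "(\<Sum>j<D. if j < K then of_int (C k j) * w j else 0) = (\<Sum>j<K. of_int (C k j) * w j)"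
      by (rule sum.mono_neutral_cong_right) (auto simp: D_def)
    finally show "aff_coord A b i w = f (\<pi> i - K) w"
      using f[OF km] i by (simp add: aff_coord_def b_def k(2))
  qed
  then have "aff_coord A b ` {..<s} = (\<lambda>i. f (\<pi> i - K)) ` {..<s}" by (intro image_cong) auto
  also have "\<dots> = (\<lambda>i. f (i - K)) ` \<pi> ` {..<s}" by (simp add: image_image)
  also have "\<dots> = f ` Z" unfolding \<pi>s by (simp add: image_image)
  finally have "aff_coord A b ` {..<s} = f ` Z" .
  then show ?thesis using sD AGL bD unfolding D_def by blast
qed


section \<open>Realizing an integral equivalence by a common framing\<close>

lemma affine_zero_set:
  assumes "int_affine N f" shows "affine {x. f x = 0}"
  unfolding affine_def
proof (intro ballI allI impI)
  fix x y and u v :: real assume *: "x \<in> {x. f x = 0}" "y \<in> {x. f x = 0}" "u + v = 1"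
  then have u: "u = 1 - v" by simp
  have "u *\<^sub>R x + v *\<^sub>R y = x + v *\<^sub>R (y - x)" unfolding u by (simp add: algebra_simps)
  then show "u *\<^sub>R x + v *\<^sub>R y \<in> {x. f x = 0}"
    using * by (simp add: int_affine_along_line[OF assms] lin_part_diff[OF assms])
qed

text \<open>
  Proportional facet functions vanish at a common point, and there transversality makes
  distinct facet functions linearly independent along the affine hull of the body.
\<close>

lemma facet_functions_commensurable_eq:
  assumes Y: "framed_polytope Y" and f: "f \<in> facet_functions Y" "f' \<in> facet_functions Y"
    and comm: "commensurable_on (body Y) f f'"
  shows "f = f'"
proof (rule ccontr)
  assume ne: "f \<noteq> f'"
  note aff = facet_functionsD(1)[OF Y f(1)] facet_functionsD(1)[OF Y f(2)]
  obtain a b where ab: "a > 0" "b > 0" "\<forall>p\<in>body Y. real a * f p = real b * f' p"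
    using comm by (rule commensurable_onE)
  obtain p where p: "p \<in> body Y" "f p = 0" using facet_functionsD(3)[OF Y f(1)] by blast
  then have "real b * f' p = 0" using bspec[OF ab(3) p(1)] by simp
  then have p': "f' p = 0" using ab(2) by simp
  obtain d where d: "\<forall>h\<in>{h \<in> facet_functions Y. h p = 0}. d h \<in> direction_space (affine hull body Y) \<and>
    (\<forall>g\<in>{h \<in> facet_functions Y. h p = 0}. lin_part g (d h) = (if g = h then 1 else 0))"
    using facet_functions_transversal[OF Y p(1)] by (elim exE)
  have mem: "f \<in> {h \<in> facet_functions Y. h p = 0}" "f' \<in> {h \<in> facet_functions Y. h p = 0}"
    using f p p' by simp_all
  have dd: "d f \<in> direction_space (affine hull body Y)" "lin_part f (d f) = 1" "lin_part f' (d f) = 0"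
    using bspec[OF d mem(1)] mem ne by simp_all
  define r where "r x = of_int (int a) * f x - of_int (int b) * f' x" for x
  have r: "int_affine (ambient_dim Y) r"
    unfolding r_def by (intro int_affine_diff int_affine_cmult aff)
  have "affine hull body Y \<subseteq> {x. r x = 0}"
    using ab(3) by (intro hull_minimal affine_zero_set[OF r]) (auto simp: r_def)
  then have zero: "r x = 0" if "x \<in> affine hull body Y" for x using that by blast
  obtain x y where "x \<in> affine hull body Y" "y \<in> affine hull body Y" "d f = x - y"
    using dd(1) unfolding direction_space_def by blast
  then have "lin_part r (d f) = 0" by (simp add: lin_part_diff[OF r] zero)
  moreover have "lin_part r (d f) = real a * lin_part f (d f) - real b * lin_part f' (d f)"
    by (simp add: r_def lin_part_def algebra_simps)
  ultimately show False using dd ab(1) by simp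
qed

text \<open>
  The data of a \<open>facet_equiv\<close> with the facets numbered so that \<open>h k\<close> and \<open>g k\<close> correspond.
\<close>

locale matched_polytopes =
  fixes X Y :: framed and S T :: "point \<Rightarrow> point" and m :: nat
    and h g :: "nat \<Rightarrow> point \<Rightarrow> real" and \<alpha> \<beta> :: "nat \<Rightarrow> nat" and V :: "point set"
  assumes X: "framed_polytope X" and Y: "framed_polytope Y"
    and S: "int_affine_map (ambient_dim X) (ambient_dim Y) S"
    and T: "int_affine_map (ambient_dim Y) (ambient_dim X) T"
    and SX: "S ` body X = body Y" and TS: "p \<in> body X \<Longrightarrow> T (S p) = p"
    and h: "h ` {..<m} = facet_functions X" and g: "g ` {..<m} = facet_functions Y"
    and h_inj: "inj_on h {..<m}"
    and \<alpha>: "k < m \<Longrightarrow> 0 < \<alpha> k" and \<beta>: "k < m \<Longrightarrow> 0 < \<beta> k"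
    and match: "k < m \<Longrightarrow> p \<in> body X \<Longrightarrow> real (\<alpha> k) * h k p = real (\<beta> k) * g k (S p)"
    and V: "openin (Euclidean_space (ambient_dim X)) V" "body X \<subseteq> V"
      "frame X \<inter> V = {x \<in> V. \<forall>f\<in>facet_functions X. 0 \<le> f x}"
begin

abbreviation N where "N \<equiv> ambient_dim X"
abbreviation M where "M \<equiv> ambient_dim Y"
abbreviation D where "D \<equiv> N + M + m"

definition \<theta>X :: "point \<Rightarrow> point"
  where "\<theta>X x = (\<lambda>i. if i < N then x i else if i < N + M then S x (i - N) else 0)"

definition \<theta>Y :: "point \<Rightarrow> point"
  where "\<theta>Y y = (\<lambda>i. if i < N then T y i else if i < N + M then y (i - N)
    else if i < D then real (\<beta> (i - (N + M))) * g (i - (N + M)) y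
      - real (\<alpha> (i - (N + M))) * h (i - (N + M)) (T y) else 0)"

definition \<rho>Y :: "point \<Rightarrow> point"
  where "\<rho>Y w = (\<lambda>j. if j < M then w (N + j) else 0)"

text \<open>
  The summand \<open>w (N + M + k)\<close> makes these functions part of an integral coordinate system.
\<close>

definition facet :: "nat \<Rightarrow> point \<Rightarrow> real"
  where "facet k w = real (\<alpha> k) * h k w + w (N + M + k)"

text \<open>
  Cutting down to \<open>V\<close> ensures that the affine hull of the body meets the frame in
  the body only.
\<close>

definition common_frame :: "point set"
  where "common_frame = {w \<in> Rn D. trunc N w \<in> V \<and> (\<forall>k<m. 0 \<le> facet k w)}"

definition common :: framed
  where "common = \<lparr>ambient_dim = D, body = \<theta>X ` body X, frame = common_frame\<rparr>"

lemma h_affine: "k < m \<Longrightarrow> int_affine N (h k)"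
  using h facet_functionsD(1)[OF X] by blast

lemma g_affine: "k < m \<Longrightarrow> int_affine M (g k)"
  using g facet_functionsD(1)[OF Y] by blast

lemma T_in: "T y \<in> Rn N"
  using T by (simp add: int_affine_map_def)

lemma \<theta>X_affine: "int_affine_map N D \<theta>X"
proof -
  have "int_affine N (\<lambda>x. \<theta>X x i)" for i
    using S unfolding \<theta>X_def int_affine_map_def
    by (cases "i < N"; cases "i < N + M") (simp_all add: int_affine_coord)
  then show ?thesis by (simp add: int_affine_map_def Rn_iff \<theta>X_def)
qed

lemma scaled_affine: "int_affine n f \<Longrightarrow> int_affine n (\<lambda>x. real a * f x)"
  using int_affine_cmult[of n f "int a"] by simp

lemma \<theta>Y_affine: "int_affine_map M D \<theta>Y"
proof -
  have "int_affine M (\<lambda>y. \<theta>Y y i)" for i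
  proof -
    consider "i < N" | "N \<le> i" "i < N + M" | "N + M \<le> i" "i < D" | "D \<le> i" by linarith
    then show ?thesis
    proof cases
      case 1
      then show ?thesis using T by (simp add: \<theta>Y_def int_affine_map_def)
    next
      case 2
      then show ?thesis by (simp add: \<theta>Y_def int_affine_coord)
    next
      case 3
      then have "i - (N + M) < m" by linarith
      then have "int_affine M (\<lambda>y. real (\<beta> (i - (N + M))) * g (i - (N + M)) y
          - real (\<alpha> (i - (N + M))) * h (i - (N + M)) (T y))"
        by (intro int_affine_diff scaled_affine g_affine int_affine_compose[OF h_affine T])
      then show ?thesis using 3 by (simp add: \<theta>Y_def)
    next
      case 4
      then show ?thesis by (simp add: \<theta>Y_def)
    qed
  qed
  then show ?thesis by (simp add: int_affine_map_def Rn_iff \<theta>Y_def)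
qed

lemma \<rho>Y_affine: "int_affine_map D M \<rho>Y"
proof -
  have "int_affine D (\<lambda>w. \<rho>Y w j)" for j
    by (cases "j < M") (simp_all add: \<rho>Y_def int_affine_coord)
  then show ?thesis by (simp add: int_affine_map_def Rn_iff \<rho>Y_def)
qed

lemma facet_affine: "k < m \<Longrightarrow> int_affine D (facet k)"
  unfolding facet_def
  by (intro int_affine_add scaled_affine int_affine_coord int_affine_mono[OF h_affine]) simp_all

lemma trunc_\<theta>X: "trunc N (\<theta>X x) = trunc N x" and trunc_\<theta>Y: "trunc N (\<theta>Y y) = T y"
  using T_in[of y] by (auto simp: trunc_def \<theta>X_def \<theta>Y_def Rn_iff fun_eq_iff)

lemma \<rho>Y_\<theta>Y: "y \<in> Rn M \<Longrightarrow> \<rho>Y (\<theta>Y y) = y"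
  by (auto simp: \<rho>Y_def \<theta>Y_def Rn_iff)

lemma facet_\<theta>X: "k < m \<Longrightarrow> facet k (\<theta>X x) = real (\<alpha> k) * h k x"
proof -
  assume k: "k < m"
  have "h k (\<theta>X x) = h k x"
    using int_affine_trunc[OF h_affine[OF k], of "\<theta>X x"] int_affine_trunc[OF h_affine[OF k], of x]
    by (simp add: trunc_\<theta>X)
  moreover have "\<theta>X x (N + M + k) = 0" by (simp add: \<theta>X_def)
  ultimately show ?thesis by (simp add: facet_def)
qed

lemma facet_\<theta>Y: "k < m \<Longrightarrow> facet k (\<theta>Y y) = real (\<beta> k) * g k y"
proof -
  assume k: "k < m"
  have "h k (\<theta>Y y) = h k (T y)"
    using int_affine_trunc[OF h_affine[OF k], of "\<theta>Y y"] by (simp add: trunc_\<theta>Y)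
  moreover have "\<theta>Y y (N + M + k) = real (\<beta> k) * g k y - real (\<alpha> k) * h k (T y)"
    using k by (simp add: \<theta>Y_def)
  ultimately show ?thesis by (simp add: facet_def)
qed

lemma \<theta>Y_S: "p \<in> body X \<Longrightarrow> \<theta>Y (S p) = \<theta>X p"
proof
  fix i assume p: "p \<in> body X"
  consider "i < N" | "N \<le> i" "i < N + M" | "N + M \<le> i" "i < D" | "D \<le> i" by linarith
  then show "\<theta>Y (S p) i = \<theta>X p i"
  proof cases
    case 3
    then have "i - (N + M) < m" by linarith
    then show ?thesis using 3 match[OF _ p, of "i - (N + M)"] TS[OF p] by (simp add: \<theta>X_def \<theta>Y_def)
  qed (simp_all add: \<theta>X_def \<theta>Y_def TS[OF p])
qed

lemma body_in: "body X \<subseteq> Rn N"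
  by (rule framed_polytopeD(3)[OF X])

lemma frame_\<theta>X_iff:
  assumes x: "x \<in> Rn N" shows "\<theta>X x \<in> common_frame \<longleftrightarrow> x \<in> frame X \<inter> V"
proof -
  have "\<theta>X x \<in> Rn D" using \<theta>X_affine by (simp add: int_affine_map_def)
  moreover have "0 \<le> facet k (\<theta>X x) \<longleftrightarrow> 0 \<le> h k x" if "k < m" for k
    using \<alpha>[OF that] by (simp add: facet_\<theta>X that zero_le_mult_iff)
  ultimately have "\<theta>X x \<in> common_frame \<longleftrightarrow> x \<in> V \<and> (\<forall>k<m. 0 \<le> h k x)"
    by (simp add: common_frame_def trunc_\<theta>X trunc_Rn[OF x])
  also have "\<dots> \<longleftrightarrow> x \<in> frame X \<inter> V" unfolding V(3) h[symmetric] by auto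
  finally show ?thesis .
qed

lemma chart:
  assumes w: "w \<in> common_frame"
  shows "\<exists>s A b. corner_chart D common_frame w s A b \<and>
    aff_coord A b ` {..<s} = facet ` {k. k < m \<and> facet k w = 0}"
proof -
  have wD: "w \<in> Rn D" using w by (simp add: common_frame_def)
  define P where "P k C c \<longleftrightarrow>
    (\<forall>w. facet k w = (\<Sum>j<N + M. of_int (C j) * w j) + w (N + M + k) + c)"
    for k and C :: "nat \<Rightarrow> int" and c :: real
  have "\<exists>C c. P k C c" if k: "k < m" for k
  proof -
    have "int_affine (N + M) (\<lambda>w. real (\<alpha> k) * h k w)"
      by (intro scaled_affine int_affine_mono[OF h_affine[OF k]]) simp
    then obtain C :: "nat \<Rightarrow> int" and c where eq:
      "(\<lambda>w. real (\<alpha> k) * h k w) = (\<lambda>w. (\<Sum>j<N + M. of_int (C j) * w j) + c)"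
      unfolding int_affine_def by blast
    have "P k C c" using fun_cong[OF eq] by (simp add: P_def facet_def)
    then show ?thesis by blast
  qed
  then obtain C c where "\<And>k. k < m \<Longrightarrow> P k (C k) (c k)" by metis
  then have form: "\<And>k w. k < m \<Longrightarrow>
      facet k w = (\<Sum>j<N + M. of_int (C k j) * w j) + w (N + M + k) + c k" unfolding P_def by blast
  define Z where "Z = {k. k < m \<and> facet k w = 0}"
  have "Z \<subseteq> {..<m}" by (auto simp: Z_def)
  from unimodular_chart[OF form this] obtain s A b where
    A: "s \<le> D" "A \<in> GL_int D" "b \<in> Rn D" "aff_coord A b ` {..<s} = facet ` Z" by blast
  have zero: "aff_coord A b i w = 0" if "i < s" for i
  proof -
    have "aff_coord A b i \<in> facet ` Z" using A(4) that by blast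
    then show ?thesis by (auto simp: Z_def)
  qed
  define U where "U = {x \<in> Rn D. trunc N x \<in> V} \<inter> {x \<in> Rn D. \<forall>k\<in>{..<m} - Z. 0 < facet k x}"
  have "openin (Euclidean_space D) U" unfolding U_def
  proof (intro openin_Int)
    show "openin (Euclidean_space D) {x \<in> Rn D. trunc N x \<in> V}"
      by (rule openin_Rn_preimage[OF V(1)])
        (simp_all add: continuous_on_int_affine_map[OF int_affine_map_trunc[of N D]])
    show "openin (Euclidean_space D) {x \<in> Rn D. \<forall>k\<in>{..<m} - Z. 0 < facet k x}"
      by (rule openin_Rn_pos) (simp_all add: facet_affine)
  qed
  moreover have "w \<in> U"
    using w by (auto simp: U_def common_frame_def Z_def less_le)
  moreover have "common_frame \<inter> U = {x \<in> U. \<forall>i<s. 0 \<le> aff_coord A b i x}"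
  proof -
    have "x \<in> common_frame \<longleftrightarrow> (\<forall>i<s. 0 \<le> aff_coord A b i x)" if x: "x \<in> U" for x
    proof -
      have "x \<in> common_frame \<longleftrightarrow> (\<forall>k\<in>Z. 0 \<le> facet k x)"
        using x unfolding common_frame_def U_def Z_def by (auto intro: less_imp_le)
      also have "\<dots> \<longleftrightarrow> (\<forall>f\<in>facet ` Z. 0 \<le> f x)" by simp
      also have "\<dots> \<longleftrightarrow> (\<forall>i<s. 0 \<le> aff_coord A b i x)" unfolding A(4)[symmetric] by auto
      finally show ?thesis .
    qed
    then show ?thesis by blast
  qed
  ultimately have "corner_chart D common_frame w s A b"
    unfolding corner_chart_def using A(1-3) zero by blast
  then show ?thesis using A(4) unfolding Z_def by blast
qed

lemma affine_hull_body: "affine hull (\<theta>X ` body X) = \<theta>X ` (affine hull body X)"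
  by (rule affine_hull_affine_image[OF linear_part_int_affine_map[OF \<theta>X_affine]])

lemma hull_in: "affine hull body X \<subseteq> Rn N"
  by (rule framed_polytopeD(7)[OF X])

lemma body_eq: "affine hull (\<theta>X ` body X) \<inter> common_frame = \<theta>X ` body X"
proof
  show "affine hull (\<theta>X ` body X) \<inter> common_frame \<subseteq> \<theta>X ` body X"
  proof
    fix w assume w: "w \<in> affine hull (\<theta>X ` body X) \<inter> common_frame"
    then obtain x where x: "x \<in> affine hull body X" "w = \<theta>X x" unfolding affine_hull_body by blast
    then have "x \<in> frame X" using frame_\<theta>X_iff[of x] hull_in w by blast
    then have "x \<in> body X" using x(1) framed_polytopeD(5)[OF X] by blast
    then show "w \<in> \<theta>X ` body X" using x(2) by blast
  qed
  show "\<theta>X ` body X \<subseteq> affine hull (\<theta>X ` body X) \<inter> common_frame"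
  proof (intro Int_greatest hull_subset image_subsetI)
    fix p assume "p \<in> body X"
    then show "\<theta>X p \<in> common_frame"
      using frame_\<theta>X_iff[of p] body_in V(2) framed_polytopeD(6)[OF X] by blast
  qed
qed

text \<open>
  On the affine hull of the body, the facet functions are positive multiples of those of \<open>X\<close>, so the
  dual vectors of the latter, divided by the factors, serve as dual vectors.
\<close>

lemma transversal_common: "transversal D (affine hull (\<theta>X ` body X)) common_frame"
proof (rule transversalI)
  show "affine (affine hull (\<theta>X ` body X))" by (rule affine_affine_hull)
  show "affine hull (\<theta>X ` body X) \<subseteq> Rn D"
    using \<theta>X_affine by (intro hull_minimal subspace_imp_affine subspace_Rn) (auto simp: int_affine_map_def)
  fix w assume w: "w \<in> affine hull (\<theta>X ` body X) \<inter> common_frame"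
  then obtain p where p: "p \<in> body X" "w = \<theta>X p" unfolding body_eq by blast
  obtain s A b where A: "corner_chart D common_frame w s A b"
    "aff_coord A b ` {..<s} = facet ` {k. k < m \<and> facet k w = 0}" using chart w by blast
  define Z where "Z = {k. k < m \<and> facet k w = 0}"
  have loc: "local_facets D common_frame w (facet ` Z)"
    using corner_chart_local_facets[OF A(1)] unfolding A(2) Z_def .
  obtain d where d: "\<forall>f\<in>{f \<in> facet_functions X. f p = 0}. d f \<in> direction_space (affine hull body X) \<and>
    (\<forall>f'\<in>{f \<in> facet_functions X. f p = 0}. lin_part f' (d f) = (if f' = f then 1 else 0))"
    using facet_functions_transversal[OF X p(1)] by (elim exE)
  have hZ: "h k \<in> {f \<in> facet_functions X. f p = 0}" if "k \<in> Z" for k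
    using that \<alpha>[of k] h p(2) unfolding Z_def by (auto simp: facet_\<theta>X)
  note sub = subspace_direction_space[OF affine_affine_hull]
  define e where "e k = (1 / real (\<alpha> k)) *\<^sub>R (\<theta>X (d (h k)) - \<theta>X 0)" for k
  have eL: "e k \<in> direction_space (affine hull (\<theta>X ` body X))" if k: "k \<in> Z" for k
  proof -
    have "d (h k) \<in> direction_space (affine hull body X)" using d hZ[OF k] by blast
    then obtain x y where xy: "x \<in> affine hull body X" "y \<in> affine hull body X" "d (h k) = x - y"
      unfolding direction_space_def by blast
    have "\<theta>X (d (h k)) - \<theta>X 0 = \<theta>X x - \<theta>X y"
      using linear_diff[OF linear_part_int_affine_map[OF \<theta>X_affine], of x y] xy(3) by simp
    then have "\<theta>X (d (h k)) - \<theta>X 0 \<in> direction_space (affine hull (\<theta>X ` body X))"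
      using xy(1,2) unfolding affine_hull_body direction_space_def by blast
    moreover have "affine hull (\<theta>X ` body X) \<noteq> {}" using p(1) by (auto simp: affine_hull_eq_empty)
    ultimately show ?thesis unfolding e_def by (intro subspace_scale[OF sub])
  qed
  have le: "lin_part (facet l) (e k) = (if l = k then 1 else 0)" if kl: "k \<in> Z" "l \<in> Z" for k l
  proof -
    have km: "k < m" "l < m" using kl by (auto simp: Z_def)
    note lin = linear_lin_part[OF facet_affine[OF km(2)]]
    have "lin_part (facet l) (e k) = (1 / real (\<alpha> k)) * lin_part (facet l) (\<theta>X (d (h k)) - \<theta>X 0)"
      unfolding e_def by (simp add: linear_scale[OF lin])
    also have "lin_part (facet l) (\<theta>X (d (h k)) - \<theta>X 0) = real (\<alpha> l) * lin_part (h l) (d (h k))"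
      by (simp add: lin_part_diff[OF facet_affine[OF km(2)]] facet_\<theta>X km lin_part_def[of "h l"] algebra_simps)
    also have "lin_part (h l) (d (h k)) = (if h l = h k then 1 else 0)"
      using bspec[OF d hZ[OF kl(1)]] hZ[OF kl(2)] by blast
    finally show ?thesis using \<alpha>[OF km(1)] h_inj km by (auto simp: inj_on_eq_iff)
  qed
  have inj: "inj_on facet Z"
  proof (rule inj_onI)
    fix k l assume kl: "k \<in> Z" "l \<in> Z" and eq: "facet k = facet l"
    have "lin_part (facet l) (e k) = lin_part (facet k) (e k)" by (simp only: eq)
    then show "k = l" using le[OF kl] le[OF kl(1,1)] by (simp split: if_splits)
  qed
  have "\<forall>f\<in>facet ` Z. (e \<circ> inv_into Z facet) f \<in> direction_space (affine hull (\<theta>X ` body X)) \<and>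
      (\<forall>f'\<in>facet ` Z. lin_part f' ((e \<circ> inv_into Z facet) f) = (if f' = f then 1 else 0))"
    using eL le inj by (simp add: inj_on_eq_iff)
  then show "\<exists>H d. local_facets D common_frame w H \<and>
      (\<forall>h\<in>H. d h \<in> direction_space (affine hull (\<theta>X ` body X)) \<and>
        (\<forall>g\<in>H. lin_part g (d h) = (if g = h then 1 else 0)))"
    using loc by blast
qed

text \<open>
  Above a point \<open>p\<close> of the body, all facet functions are positive at the point \<open>q\<close> whose last \<open>m\<close>
  coordinates are \<open>1\<close>.
\<close>

lemma has_aff_dim_common_frame: "has_aff_dim common_frame D"
proof -
  obtain p where p: "p \<in> body X" using framed_polytopeD(2)[OF X] by blast
  define U where "U = {x \<in> Rn D. trunc N x \<in> V} \<inter> {x \<in> Rn D. \<forall>k\<in>{..<m}. 0 < facet k x}"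
  have "openin (Euclidean_space D) U" unfolding U_def
  proof (intro openin_Int)
    show "openin (Euclidean_space D) {x \<in> Rn D. trunc N x \<in> V}"
      by (rule openin_Rn_preimage[OF V(1)])
        (simp_all add: continuous_on_int_affine_map[OF int_affine_map_trunc[of N D]])
    show "openin (Euclidean_space D) {x \<in> Rn D. \<forall>k\<in>{..<m}. 0 < facet k x}"
      by (rule openin_Rn_pos) (simp_all add: facet_affine)
  qed
  moreover define q :: point where "q = (\<lambda>i. if i < N then p i else if N + M \<le> i \<and> i < D then 1 else 0)"
  have "p \<in> Rn N" using p body_in by blast
  then have tq: "trunc N q = p" by (auto simp: trunc_def q_def Rn_iff)
  have "0 < facet k q" if "k < m" for k
  proof -
    have "h k q = h k p" using int_affine_trunc[OF h_affine[OF that], of q] by (simp add: tq)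
    moreover have "0 \<le> h k p" using facet_functionsD(2)[OF X _ p] h that by blast
    ultimately show ?thesis using that by (simp add: facet_def q_def add_nonneg_pos)
  qed
  then have "q \<in> U" using p V(2) by (auto simp: U_def tq) (auto simp: q_def Rn_iff)
  moreover have "U \<subseteq> common_frame" unfolding U_def common_frame_def by (auto intro: less_imp_le)
  moreover have "common_frame \<subseteq> Rn D" unfolding common_frame_def by blast
  ultimately show ?thesis by (intro has_aff_dim_nonempty_interior)
qed

lemma inj_\<theta>X: "inj_on \<theta>X (Rn N)"
  by (rule inj_on_inverseI[of _ "trunc N"]) (simp add: trunc_\<theta>X trunc_Rn)

lemma framed_common: "framed_polytope common"
proof -
  obtain n where n: "simple_polytope n (body X)" using X unfolding framed_polytope_def by blast
  have "simple_polytope n (\<theta>X ` body X)"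
    by (rule simple_polytope_int_affine_image[OF \<theta>X_affine inj_\<theta>X n body_in])
  moreover have "regular_rational_framing D (\<theta>X ` body X) (affine hull (\<theta>X ` body X)) common_frame"
    unfolding regular_rational_framing_def
  proof (intro conjI refl ballI)
    show "common_frame \<subseteq> Rn D" by (auto simp: common_frame_def)
    show "\<exists>s A b. corner_chart D common_frame w s A b" if "w \<in> common_frame" for w
      using chart[OF that] by blast
  qed (fact has_aff_dim_common_frame transversal_common body_eq)+
  moreover have "\<theta>X ` body X \<subseteq> Rn D" using \<theta>X_affine by (auto simp: int_affine_map_def)
  ultimately show ?thesis unfolding framed_polytope_def common_def by auto
qed

lemma embedding_\<theta>X: "morita_embedding X common \<theta>X"
proof -
  have "integral_affine_embedding N D \<theta>X"
    by (rule integral_affine_embeddingI[OF \<theta>X_affine int_affine_map_trunc])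
      (simp_all add: trunc_\<theta>X trunc_Rn)
  moreover have "nbhd_in N (frame X) (body X) (V \<inter> frame X)"
    unfolding nbhd_in_def openin_subtopology using V(1,2) framed_polytopeD(6)[OF X] by blast
  moreover have "nbhd_in D common_frame (\<theta>X ` body X) common_frame"
    unfolding nbhd_in_def openin_subtopology_refl using body_eq by (auto simp: common_frame_def)
  moreover have "\<theta>X ` (V \<inter> frame X) = common_frame \<inter> \<theta>X ` Rn N"
    using frame_\<theta>X_iff framed_polytopeD(4)[OF X] by blast
  ultimately show ?thesis unfolding morita_embedding_def common_def by auto
qed

lemma embedding_\<theta>Y: "morita_embedding Y common \<theta>Y"
proof -
  obtain V' where V': "openin (Euclidean_space M) V'" "body Y \<subseteq> V'"
    "frame Y \<inter> V' = {x \<in> V'. \<forall>f\<in>facet_functions Y. 0 \<le> f x}" by (rule frame_eq_facets_near_body[OF Y])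
  define U2 where "U2 = (V' \<inter> {y \<in> Rn M. T y \<in> V}) \<inter> frame Y"
  define U1 where "U1 = {w \<in> Rn D. \<rho>Y w \<in> V'} \<inter> common_frame"
  have body: "\<theta>Y ` body Y = \<theta>X ` body X"
    unfolding SX[symmetric] image_image by (intro image_cong refl \<theta>Y_S)
  have TY: "T q \<in> V" if "q \<in> body Y" for q
    using that TS V(2) unfolding SX[symmetric] by auto
  have YM: "body Y \<subseteq> Rn M" "frame Y \<subseteq> Rn M" "body Y \<subseteq> frame Y" using framed_polytopeD[OF Y] by auto
  have "integral_affine_embedding M D \<theta>Y"
    by (rule integral_affine_embeddingI[OF \<theta>Y_affine \<rho>Y_affine]) (simp_all add: \<rho>Y_\<theta>Y)
  moreover have "nbhd_in M (frame Y) (body Y) U2"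
    unfolding nbhd_in_def openin_subtopology U2_def
  proof (intro conjI exI)
    show "openin (Euclidean_space M) (V' \<inter> {y \<in> Rn M. T y \<in> V})"
      by (intro openin_Int V'(1) openin_Rn_preimage[OF V(1)] continuous_on_int_affine_map[OF T] T_in)
  qed (use V'(2) TY YM in auto)
  moreover have "nbhd_in D common_frame (\<theta>X ` body X) U1"
    unfolding nbhd_in_def openin_subtopology U1_def
  proof (intro conjI exI)
    show "openin (Euclidean_space D) {w \<in> Rn D. \<rho>Y w \<in> V'}"
      using \<rho>Y_affine by (intro openin_Rn_preimage[OF V'(1)] continuous_on_int_affine_map[OF \<rho>Y_affine])
        (auto simp: int_affine_map_def)
    show "\<theta>X ` body X \<subseteq> {w \<in> Rn D. \<rho>Y w \<in> V'} \<inter> common_frame"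
    proof (rule Int_greatest)
      show "\<theta>X ` body X \<subseteq> common_frame" using body_eq by blast
      show "\<theta>X ` body X \<subseteq> {w \<in> Rn D. \<rho>Y w \<in> V'}"
      proof (unfold body[symmetric], rule image_subsetI)
        fix q assume "q \<in> body Y"
        then have "q \<in> Rn M" "q \<in> V'" using YM(1) V'(2) by blast+
        then have "\<rho>Y (\<theta>Y q) \<in> V'" by (simp add: \<rho>Y_\<theta>Y)
        then show "\<theta>Y q \<in> {w \<in> Rn D. \<rho>Y w \<in> V'}" using \<theta>Y_affine by (simp add: int_affine_map_def)
      qed
    qed
  qed simp
  moreover have "\<theta>Y ` U2 = U1 \<inter> \<theta>Y ` Rn M"
  proof -
    have "\<theta>Y y \<in> U1 \<longleftrightarrow> y \<in> U2" if y: "y \<in> Rn M" for y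
    proof -
      have "\<theta>Y y \<in> Rn D" using \<theta>Y_affine by (simp add: int_affine_map_def)
      moreover have "0 \<le> facet k (\<theta>Y y) \<longleftrightarrow> 0 \<le> g k y" if "k < m" for k
        using \<beta>[OF that] by (simp add: facet_\<theta>Y that zero_le_mult_iff)
      ultimately have "\<theta>Y y \<in> U1 \<longleftrightarrow> y \<in> V' \<and> T y \<in> V \<and> (\<forall>k<m. 0 \<le> g k y)"
        by (simp add: U1_def common_frame_def trunc_\<theta>Y \<rho>Y_\<theta>Y[OF y])
      also have "(\<forall>k<m. 0 \<le> g k y) \<longleftrightarrow> (\<forall>f\<in>facet_functions Y. 0 \<le> f y)" unfolding g[symmetric] by auto
      finally show ?thesis unfolding U2_def using V'(3) y by blast
    qed
    moreover have "U2 \<subseteq> Rn M" using YM unfolding U2_def by blast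
    ultimately show ?thesis by blast
  qed
  ultimately show ?thesis unfolding morita_embedding_def common_def using body by auto
qed

end

text \<open>
  Since distinct facet functions of \<open>Y\<close> are not commensurable, any choice of a partner for each facet
  function of \<open>X\<close> reaches all facet functions of \<open>Y\<close>.
\<close>

lemma facet_equiv_imp_morita_equivalent:
  assumes X: "framed_polytope X" and Y: "framed_polytope Y" and "facet_equiv X Y"
  shows "morita_equivalent X Y"
proof -
  obtain S T where ST: "int_affine_map (ambient_dim X) (ambient_dim Y) S"
    "int_affine_map (ambient_dim Y) (ambient_dim X) T" "S ` body X = body Y" "\<forall>p\<in>body X. T (S p) = p"
    and F: "\<forall>h\<in>facet_functions X. \<exists>g\<in>facet_functions Y. commensurable_on (body X) h (\<lambda>p. g (S p))"
    "\<forall>g\<in>facet_functions Y. \<exists>h\<in>facet_functions X. commensurable_on (body X) h (\<lambda>p. g (S p))"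
    using assms(3) unfolding facet_equiv_def by blast
  obtain V where V: "openin (Euclidean_space (ambient_dim X)) V" "body X \<subseteq> V"
    "frame X \<inter> V = {x \<in> V. \<forall>f\<in>facet_functions X. 0 \<le> f x}" by (rule frame_eq_facets_near_body[OF X])
  obtain h where h: "bij_betw h {0..<card (facet_functions X)} (facet_functions X)"
    using ex_bij_betw_nat_finite[OF finite_facet_functions[OF X]] by blast
  define m where "m = card (facet_functions X)"
  have hm: "h ` {..<m} = facet_functions X" "inj_on h {..<m}"
    using h by (auto simp: bij_betw_def m_def atLeast0LessThan)
  obtain G where G: "\<forall>f\<in>facet_functions X. G f \<in> facet_functions Y \<and> commensurable_on (body X) f (\<lambda>p. G f (S p))"
    using bchoice[of "facet_functions X" "\<lambda>f g. g \<in> facet_functions Y \<and> commensurable_on (body X) f (\<lambda>p. g (S p))"] F(1)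
    by blast
  define g where "g k = G (h k)" for k
  have g: "g k \<in> facet_functions Y" "commensurable_on (body X) (h k) (\<lambda>p. g k (S p))" if "k < m" for k
    using G hm(1) that unfolding g_def by blast+
  have "facet_functions Y \<subseteq> g ` {..<m}"
  proof
    fix f assume f: "f \<in> facet_functions Y"
    obtain f' where f': "f' \<in> facet_functions X" "commensurable_on (body X) f' (\<lambda>p. f (S p))" using F(2) f by blast
    then obtain k where k: "k < m" "f' = h k" using hm(1) by blast
    obtain a b where ab: "a > 0" "b > 0" "\<forall>p\<in>body X. real a * h k p = real b * f (S p)"
      using f'(2) unfolding k(2) by (rule commensurable_onE)
    obtain a' b' where ab': "a' > 0" "b' > 0" "\<forall>p\<in>body X. real a' * h k p = real b' * g k (S p)"
      using g(2)[OF k(1)] by (rule commensurable_onE)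
    have "commensurable_on (body Y) f (g k)"
    proof (rule commensurable_onI[of "a' * b" "a * b'"])
      fix q assume "q \<in> body Y"
      then obtain p where p: "p \<in> body X" "q = S p" using ST(3) by blast
      have "real (a' * b) * f q = real a' * (real a * h k p)" using bspec[OF ab(3) p(1)] p(2) by simp
      also have "\<dots> = real a * (real a' * h k p)" by simp
      also have "\<dots> = real (a * b') * g k q" using bspec[OF ab'(3) p(1)] p(2) by simp
      finally show "real (a' * b) * f q = real (a * b') * g k q" .
    qed (use ab ab' in simp_all)
    then have "f = g k" using facet_functions_commensurable_eq[OF Y f g(1)[OF k(1)]] by blast
    then show "f \<in> g ` {..<m}" using k(1) by blast
  qed
  then have gm: "g ` {..<m} = facet_functions Y" using g(1) by blast
  have "\<forall>k. \<exists>a b. k < m \<longrightarrow> a > 0 \<and> b > 0 \<and> (\<forall>p\<in>body X. real a * h k p = real b * g k (S p))"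
    using g(2) unfolding commensurable_on_def by blast
  then obtain \<alpha> where "\<forall>k. \<exists>b. k < m \<longrightarrow> \<alpha> k > 0 \<and> b > 0 \<and> (\<forall>p\<in>body X. real (\<alpha> k) * h k p = real b * g k (S p))"
    using choice[of "\<lambda>k a. \<exists>b. k < m \<longrightarrow> a > 0 \<and> b > 0 \<and> (\<forall>p\<in>body X. real a * h k p = real b * g k (S p))"] by blast
  then obtain \<beta> where \<beta>: "\<forall>k. k < m \<longrightarrow> \<alpha> k > 0 \<and> \<beta> k > 0 \<and> (\<forall>p\<in>body X. real (\<alpha> k) * h k p = real (\<beta> k) * g k (S p))"
    using choice[of "\<lambda>k b. k < m \<longrightarrow> \<alpha> k > 0 \<and> b > 0 \<and> (\<forall>p\<in>body X. real (\<alpha> k) * h k p = real b * g k (S p))"] by blast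
  interpret matched_polytopes X Y S T m h g \<alpha> \<beta> V
    by unfold_locales (use X Y ST hm gm \<beta> V in simp_all)
  show ?thesis unfolding morita_equivalent_def using framed_common embedding_\<theta>X embedding_\<theta>Y by blast
qed

lemma morita_equivalent_iff_facet_equiv:
  assumes "framed_polytope X" "framed_polytope Y"
  shows "morita_equivalent X Y \<longleftrightarrow> facet_equiv X Y"
proof
  assume "morita_equivalent X Y"
  then obtain Z \<eta> \<eta>' where Z: "framed_polytope Z" "morita_embedding X Z \<eta>" "morita_embedding Y Z \<eta>'"
    unfolding morita_equivalent_def by blast
  have "facet_equiv X Z" by (rule morita_embedding_facet_equiv[OF Z(2) assms(1) Z(1)])
  moreover have "facet_equiv Z Y"
    by (rule facet_equiv_sym[OF morita_embedding_facet_equiv[OF Z(3) assms(2) Z(1)]])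
  ultimately show "facet_equiv X Y" by (rule facet_equiv_trans)
qed (rule facet_equiv_imp_morita_equivalent[OF assms])

theorem theorem3p13:
  shows "equiv {X. framed_polytope X}
    {(X, Y). framed_polytope X \<and> framed_polytope Y \<and> morita_equivalent X Y}"
proof (rule equivI)
  let ?R = "{(X, Y). framed_polytope X \<and> framed_polytope Y \<and> morita_equivalent X Y}"
  show "?R \<subseteq> {X. framed_polytope X} \<times> {X. framed_polytope X}" by blast
  show "refl_on {X. framed_polytope X} ?R"
    by (rule refl_onI) (simp add: morita_equivalent_iff_facet_equiv facet_equiv_refl)
  show "sym ?R"
    by (rule symI) (auto simp: morita_equivalent_iff_facet_equiv intro: facet_equiv_sym)
  show "trans ?R"
    by (rule transI) (auto simp: morita_equivalent_iff_facet_equiv intro: facet_equiv_trans)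
qed

end
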